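(* For a finite group $G$, let $\mathrm{T}(G)$ denote one of the following four types of graph on $G$ (the same type for all groups): the commuting graph, the power graph, the enhanced power graph, the deep commuting graph. If $G$ and $H$ are finite groups such that $\mathrm{T}(G)$ and $\mathrm{T}(H)$ are isomorphic as graphs, then the Gruenberg--Kegel graphs of $G$ and $H$ are equal.
   Context: Each of the four graphs on a finite group $G$ is a simple undirected graph with vertex set the set of all elements of $G$; two distinct elements $g,h\in G$ are adjacent - in the commuting graph, if $gh=hg$; - in the power graph, if one of $g$ and $h$ is a power of the other; - in the enhanced power graph, if $\langle g,h\rangle$ is cyclic; - in the deep commuting graph, if the inverse images of $g$ and $h$ commute in every central extension of $G$ (that is, for every group $K$ with central subgroup $Z$ and $K/Z\cong G$, all preimages of $g$ in $K$ commute with all preimages of $h$). The Gruenberg--Kegel graph of a finite group $G$ is the simple graph whose vertices are the prime divisors of $|G|$, with distinct $p,q$ adjacent if and only if $G$ contains an element of order $pq$. Two Gruenberg--Kegel graphs are equal if they have the same set of primes as vertices and the same pairs of primes are adjacent. *)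

theory Defs
  imports
    "HOL-Algebra.Multiplicative_Group"
    "HOL-Library.Countable_Set"
    "HOL-Computational_Algebra.Primes"
    "Graph_Theory.Pair_Digraph"
    "Graph_Theory.Digraph_Isomorphism"
begin

text \<open>As usual in \<^theory>\<open>Graph_Theory.Pair_Digraph\<close>, a simple undirected graph is a loop-free
  symmetric pair digraph (locale \<^locale>\<open>pair_graph\<close>): the edge between \<open>x\<close> and \<open>y\<close> is the
  pair of arcs \<open>(x, y)\<close> and \<open>(y, x)\<close>.\<close>

definition simple_graph :: "'a set \<Rightarrow> ('a \<Rightarrow> 'a \<Rightarrow> bool) \<Rightarrow> 'a pair_pre_digraph" where
  "simple_graph V adj =
     \<lparr>pverts = V, parcs = {(x, y). x \<in> V \<and> y \<in> V \<and> x \<noteq> y \<and> adj x y}\<rparr>"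

definition graph_isomorphic :: "'a pair_pre_digraph \<Rightarrow> 'b pair_pre_digraph \<Rightarrow> bool" where
  "graph_isomorphic A B \<longleftrightarrow> digraph_iso (with_proj A) (with_proj B)"

definition commuting_graph :: "('a, 'm) monoid_scheme \<Rightarrow> 'a pair_pre_digraph" where
  "commuting_graph G = simple_graph (carrier G) (\<lambda>g h. g \<otimes>\<^bsub>G\<^esub> h = h \<otimes>\<^bsub>G\<^esub> g)"

definition power_graph :: "('a, 'm) monoid_scheme \<Rightarrow> 'a pair_pre_digraph" where
  "power_graph G = simple_graph (carrier G)
     (\<lambda>g h. (\<exists>k::int. h = g [^]\<^bsub>G\<^esub> k) \<or> (\<exists>k::int. g = h [^]\<^bsub>G\<^esub> k))"

definition enhanced_power_graph :: "('a, 'm) monoid_scheme \<Rightarrow> 'a pair_pre_digraph" where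
  "enhanced_power_graph G = simple_graph (carrier G)
     (\<lambda>g h. cyclic_group (subgroup_generated G {g, h}))"

text \<open>A central extension of \<open>G\<close> is a group \<open>K\<close> with a central subgroup \<open>Z\<close> and an isomorphism
  \<open>\<pi>\<close> from \<open>K/Z\<close> to \<open>G\<close>; the preimages of \<open>g\<close> are the \<open>x \<in> K\<close> whose coset is mapped to \<open>g\<close>.\<close>

definition central_subgroup :: "'k set \<Rightarrow> ('k, 'n) monoid_scheme \<Rightarrow> bool" where
  "central_subgroup Z K \<longleftrightarrow>
     subgroup Z K \<and> (\<forall>z\<in>Z. \<forall>x\<in>carrier K. z \<otimes>\<^bsub>K\<^esub> x = x \<otimes>\<^bsub>K\<^esub> z)"

definition central_extension ::
  "('k, 'n) monoid_scheme \<Rightarrow> 'k set \<Rightarrow> ('k set \<Rightarrow> 'a) \<Rightarrow> ('a, 'm) monoid_scheme \<Rightarrow> bool" where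
  "central_extension K Z \<pi> G \<longleftrightarrow> group K \<and> central_subgroup Z K \<and> \<pi> \<in> iso (K Mod Z) G"

definition preimages_commute ::
  "('k, 'n) monoid_scheme \<Rightarrow> 'k set \<Rightarrow> ('k set \<Rightarrow> 'a) \<Rightarrow> 'a \<Rightarrow> 'a \<Rightarrow> bool" where
  "preimages_commute K Z \<pi> g h \<longleftrightarrow>
     (\<forall>x\<in>carrier K. \<forall>y\<in>carrier K.
        \<pi> (Z #>\<^bsub>K\<^esub> x) = g \<longrightarrow> \<pi> (Z #>\<^bsub>K\<^esub> y) = h \<longrightarrow> x \<otimes>\<^bsub>K\<^esub> y = y \<otimes>\<^bsub>K\<^esub> x)"

text \<open>HOL cannot quantify over all types inside a definition, so the extensions \<open>K\<close> range over the
  (finite or countable) groups whose elements are natural numbers. For finite \<open>G\<close> this is no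
  restriction: by \<open>deep_commute_preimages_commute\<close> below, the preimages then commute in every
  central extension of \<open>G\<close>, over an arbitrary type and of arbitrary cardinality.\<close>

definition deep_commute :: "('a, 'm) monoid_scheme \<Rightarrow> 'a \<Rightarrow> 'a \<Rightarrow> bool" where
  "deep_commute G g h \<longleftrightarrow>
     (\<forall>(K :: nat monoid) Z \<pi>. central_extension K Z \<pi> G \<longrightarrow> preimages_commute K Z \<pi> g h)"

definition deep_commuting_graph :: "('a, 'm) monoid_scheme \<Rightarrow> 'a pair_pre_digraph" where
  "deep_commuting_graph G = simple_graph (carrier G) (deep_commute G)"

datatype graph_type = Commuting | Power | Enhanced_Power | Deep_Commuting

fun group_graph :: "graph_type \<Rightarrow> ('a, 'm) monoid_scheme \<Rightarrow> 'a pair_pre_digraph" where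
  "group_graph Commuting G = commuting_graph G"
| "group_graph Power G = power_graph G"
| "group_graph Enhanced_Power G = enhanced_power_graph G"
| "group_graph Deep_Commuting G = deep_commuting_graph G"

definition gruenberg_kegel_graph :: "('a, 'm) monoid_scheme \<Rightarrow> nat pair_pre_digraph" where
  "gruenberg_kegel_graph G = simple_graph {p. Factorial_Ring.prime p \<and> p dvd order G}
     (\<lambda>p q. \<exists>g\<in>carrier G. group.ord G g = p * q)"


lemma pair_graph_simple_graph:
  assumes "finite V" and sym: "\<And>x y. x \<in> V \<Longrightarrow> y \<in> V \<Longrightarrow> adj x y \<Longrightarrow> adj y x"
  shows "pair_graph (simple_graph V adj)"
proof -
  have "finite (parcs (simple_graph V adj))"
    by (rule finite_subset[of _ "V \<times> V"]) (auto simp: simple_graph_def assms(1))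
  then show ?thesis
    by unfold_locales
      (auto simp: simple_graph_def assms(1) symmetric_def sym_def intro: sym)
qed

lemma pair_graph_group_graph:
  assumes "group G" "finite (carrier G)"
  shows "pair_graph (group_graph T G)"
proof -
  have "deep_commute G y x" if "deep_commute G x y" for x y
    using that unfolding deep_commute_def preimages_commute_def by metis
  moreover have "{x, y} = {y, x}" for x y :: 'a
    by auto
  ultimately show ?thesis
    by (cases T) (auto simp: commuting_graph_def power_graph_def enhanced_power_graph_def
        deep_commuting_graph_def assms insert_commute intro!: pair_graph_simple_graph)
qed

lemma pair_graph_gruenberg_kegel_graph:
  assumes "group G" "finite (carrier G)"
  shows "pair_graph (gruenberg_kegel_graph G)"
proof -
  have "order G > 0"
    using assms by (simp add: group.is_monoid monoid.order_gt_0_iff_finite)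
  then show ?thesis
    unfolding gruenberg_kegel_graph_def
    by (intro pair_graph_simple_graph) (auto simp: mult.commute)
qed

lemma graph_isomorphic_simple_graph:
  "graph_isomorphic (simple_graph V adj) (simple_graph W adj') \<longleftrightarrow>
     (\<exists>f. bij_betw f V W \<and> (\<forall>x\<in>V. \<forall>y\<in>V. x \<noteq> y \<longrightarrow> adj x y = adj' (f x) (f y)))"
  (is "?L \<longleftrightarrow> ?R")
proof
  assume ?L
  then obtain \<phi> where
    iso: "pre_digraph.digraph_isomorphism (with_proj (simple_graph V adj)) \<phi>" and
    app: "with_proj (simple_graph W adj') = app_iso \<phi> (with_proj (simple_graph V adj))"
    unfolding graph_isomorphic_def digraph_iso_def by blast
  define f where "f = iso_verts \<phi>"
  have V: "W = f ` V"
    using arg_cong[OF app, of verts] by (simp add: simple_graph_def f_def)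
  have A: "parcs (simple_graph W adj') = iso_arcs \<phi> ` parcs (simple_graph V adj)"
    using arg_cong[OF app, of arcs] by simp
  have T: "iso_tail \<phi> = fst" "iso_head \<phi> = snd"
    using arg_cong[OF app, of tail] arg_cong[OF app, of head] by simp_all
  have inj: "inj_on f V"
    using iso by (simp add: pre_digraph.digraph_isomorphism_def f_def simple_graph_def)
  have arc: "iso_arcs \<phi> (x, y) = (f x, f y)" if "(x, y) \<in> parcs (simple_graph V adj)" for x y
    using iso that
    by (auto simp: pre_digraph.digraph_isomorphism_def f_def T prod_eq_iff)
  have "adj x y = adj' (f x) (f y)" if xy: "x \<in> V" "y \<in> V" "x \<noteq> y" for x y
  proof
    assume "adj x y"
    then have "(x, y) \<in> parcs (simple_graph V adj)"
      using xy by (simp add: simple_graph_def)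
    then have "(f x, f y) \<in> parcs (simple_graph W adj')"
      using A arc by force
    then show "adj' (f x) (f y)" by (simp add: simple_graph_def)
  next
    assume "adj' (f x) (f y)"
    then have "(f x, f y) \<in> parcs (simple_graph W adj')"
      using xy inj V by (auto simp: simple_graph_def inj_on_eq_iff)
    then obtain u v where uv: "(u, v) \<in> parcs (simple_graph V adj)" "(f x, f y) = iso_arcs \<phi> (u, v)"
      using A by auto
    then have "f u = f x" "f v = f y" "u \<in> V" "v \<in> V" "adj u v"
      using arc by (auto simp: simple_graph_def)
    then show "adj x y"
      using inj xy by (auto dest: inj_onD)
  qed
  then show ?R
    using V inj by (auto simp: bij_betw_def)
next
  assume ?R
  then obtain f where f: "inj_on f V" "f ` V = W"
    and adj: "\<And>x y. x \<in> V \<Longrightarrow> y \<in> V \<Longrightarrow> x \<noteq> y \<Longrightarrow> adj x y = adj' (f x) (f y)"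
    by (auto simp: bij_betw_def)
  define \<phi> where "\<phi> = \<lparr>iso_verts = f, iso_arcs = map_prod f f, iso_head = snd, iso_tail = fst\<rparr>"
  have "wf_digraph (with_proj (simple_graph V adj))"
    by unfold_locales (auto simp: simple_graph_def)
  moreover have "inj_on (map_prod f f) (parcs (simple_graph V adj))"
    by (rule inj_on_subset[OF map_prod_inj_on[OF f(1) f(1)]]) (auto simp: simple_graph_def)
  ultimately have "pre_digraph.digraph_isomorphism (with_proj (simple_graph V adj)) \<phi>"
    using f(1) by (auto simp: pre_digraph.digraph_isomorphism_def \<phi>_def simple_graph_def)
  moreover have "parcs (simple_graph W adj') = map_prod f f ` parcs (simple_graph V adj)"
  proof (intro equalityI subsetI)
    fix e assume "e \<in> parcs (simple_graph W adj')"
    then obtain x y where e: "e = (f x, f y)" and xy: "x \<in> V" "y \<in> V" "f x \<noteq> f y" "adj' (f x) (f y)"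
      using f(2) by (auto simp: simple_graph_def)
    then have "(x, y) \<in> parcs (simple_graph V adj)"
      using adj by (auto simp: simple_graph_def)
    then show "e \<in> map_prod f f ` parcs (simple_graph V adj)"
      using e by force
  next
    fix e assume "e \<in> map_prod f f ` parcs (simple_graph V adj)"
    then show "e \<in> parcs (simple_graph W adj')"
      using f adj by (auto simp: simple_graph_def inj_on_eq_iff)
  qed
  then have "with_proj (simple_graph W adj') = app_iso \<phi> (with_proj (simple_graph V adj))"
    using f(2) by (simp add: with_proj_def app_iso_def \<phi>_def) (simp add: simple_graph_def)
  ultimately show ?L
    unfolding graph_isomorphic_def digraph_iso_def by blast
qed

lemma (in group) countable_generate:
  assumes "A \<subseteq> carrier G" "countable A"
  shows "countable (generate G A)"
proof -
  define B where "B = A \<union> m_inv G ` A"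
  define ev where "ev w = foldr (\<otimes>) w \<one>" for w
  have B: "B \<subseteq> carrier G" using assms(1) by (auto simp: B_def)
  have ev_closed: "ev w \<in> carrier G" if "w \<in> lists B" for w
    using that B by (induction w) (auto simp: ev_def)
  have ev_append: "ev (u @ w) = ev u \<otimes> ev w" if "u \<in> lists B" "w \<in> lists B" for u w
    using that(1)
  proof (induction u)
    case Nil
    then show ?case using ev_closed[OF that(2)] by (simp add: ev_def)
  next
    case (Cons a u)
    then have "a \<in> carrier G" using B by auto
    moreover have "ev ((a # u) @ w) = a \<otimes> ev (u @ w)" "ev (a # u) = a \<otimes> ev u"
      by (simp_all add: ev_def)
    ultimately show ?case
      using Cons ev_closed[OF Cons(2)] ev_closed[OF that(2)] by (simp add: m_assoc)
  qed
  have "x \<in> ev ` lists B" if "x \<in> generate G A" for x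
    using that
  proof induction
    case one
    show ?case by (rule image_eqI[of _ _ "[]"]) (auto simp: ev_def)
  next
    case (incl h)
    then show ?case using assms(1)
      by (intro image_eqI[of _ _ "[h]"]) (auto simp: ev_def B_def)
  next
    case (inv h)
    then show ?case using assms(1)
      by (intro image_eqI[of _ _ "[inv h]"]) (auto simp: ev_def B_def)
  next
    case (eng x y)
    then obtain u w where "u \<in> lists B" "w \<in> lists B" "x = ev u" "y = ev w"
      by auto
    then show ?case
      by (intro image_eqI[of _ _ "u @ w"]) (auto simp: ev_append)
  qed
  moreover have "countable (lists B)"
    using assms(2) by (simp add: B_def)
  ultimately show ?thesis
    by (meson countable_image countable_subset subsetI)
qed

lemma deep_commute_preimages_commute:
  fixes K :: "('k, 'n) monoid_scheme" and G :: "('a, 'm) monoid_scheme"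
  assumes G: "group G" "finite (carrier G)"
    and deep: "deep_commute G g h"
    and ext: "central_extension K Z \<pi> G"
  shows "preimages_commute K Z \<pi> g h"
proof -
  interpret G: group G by fact
  interpret K: group K using ext by (simp add: central_extension_def)
  have cent: "subgroup Z K" "\<And>z x. z \<in> Z \<Longrightarrow> x \<in> carrier K \<Longrightarrow> z \<otimes>\<^bsub>K\<^esub> x = x \<otimes>\<^bsub>K\<^esub> z"
    and iso: "\<pi> \<in> iso (K Mod Z) G"
    using ext by (auto simp: central_extension_def central_subgroup_def)
  interpret Z: subgroup Z K by fact
  interpret Z: normal Z K
  proof (rule K.normalI[OF cent(1)], rule ballI)
    fix x assume x: "x \<in> carrier K"
    show "Z #>\<^bsub>K\<^esub> x = x <#\<^bsub>K\<^esub> Z"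
      unfolding r_coset_def l_coset_def using cent(2)[OF _ x] by (intro SUP_cong) auto
  qed
  define \<psi> where "\<psi> x = \<pi> (Z #>\<^bsub>K\<^esub> x)" for x
  have \<pi>_bij: "bij_betw \<pi> (carrier (K Mod Z)) (carrier G)" and \<pi>_hom: "\<pi> \<in> hom (K Mod Z) G"
    using iso by (auto simp: iso_def)
  have coset: "Z #>\<^bsub>K\<^esub> x \<in> carrier (K Mod Z)" if "x \<in> carrier K" for x
    using that by (auto simp: FactGroup_def RCOSETS_def)
  have \<psi>_hom: "\<psi> \<in> hom K G"
  proof (rule homI)
    fix x assume "x \<in> carrier K"
    then show "\<psi> x \<in> carrier G" unfolding \<psi>_def using coset \<pi>_hom by (auto simp: hom_def)
  next
    fix x y assume xy: "x \<in> carrier K" "y \<in> carrier K"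
    then show "\<psi> (x \<otimes>\<^bsub>K\<^esub> y) = \<psi> x \<otimes>\<^bsub>G\<^esub> \<psi> y"
      unfolding \<psi>_def using hom_mult[OF \<pi>_hom coset[OF xy(1)] coset[OF xy(2)]]
      by (simp add: FactGroup_def Z.rcos_sum)
  qed
  have "group_hom K G \<psi>"
    by (intro group_hom.intro group_hom_axioms.intro K.is_group G.is_group \<psi>_hom)
  then interpret \<psi>: group_hom K G \<psi> .
  have \<psi>_surj: "\<exists>x\<in>carrier K. \<psi> x = a" if "a \<in> carrier G" for a
  proof -
    have "a \<in> \<pi> ` carrier (K Mod Z)"
      using that bij_betw_imp_surj_on[OF \<pi>_bij] by simp
    then show ?thesis by (auto simp: FactGroup_def RCOSETS_def \<psi>_def)
  qed
  have \<psi>_ker: "x \<in> Z" if "x \<in> carrier K" "\<psi> x = \<one>\<^bsub>G\<^esub>" for x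
  proof -
    have "\<psi> x = \<psi> \<one>\<^bsub>K\<^esub>" using that(2) by simp
    then have "Z #>\<^bsub>K\<^esub> x = Z #>\<^bsub>K\<^esub> \<one>\<^bsub>K\<^esub>"
      unfolding \<psi>_def using \<pi>_bij coset[OF that(1)] coset[OF K.one_closed]
      by (auto dest: inj_onD[OF bij_betw_imp_inj_on])
    moreover have "Z #>\<^bsub>K\<^esub> \<one>\<^bsub>K\<^esub> = Z"
      by (rule K.coset_mult_one[OF Z.subset])
    moreover have "x \<in> Z #>\<^bsub>K\<^esub> x"
      by (rule K.rcos_self[OF that(1) cent(1)])
    ultimately show ?thesis by simp
  qed
  show ?thesis
    unfolding preimages_commute_def
  proof (intro ballI impI)
    fix x y assume xy: "x \<in> carrier K" "y \<in> carrier K"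
      and pre: "\<pi> (Z #>\<^bsub>K\<^esub> x) = g" "\<pi> (Z #>\<^bsub>K\<^esub> y) = h"
    define s where "s a = (SOME u. u \<in> carrier K \<and> \<psi> u = a)" for a
    have s: "s a \<in> carrier K" "\<psi> (s a) = a" if "a \<in> carrier G" for a
      using someI_ex[of "\<lambda>u. u \<in> carrier K \<and> \<psi> u = a"] \<psi>_surj[OF that]
      by (auto simp: s_def)
    define A where "A = {x, y} \<union> s ` carrier G"
    define S where "S = generate K A"
    have A: "A \<subseteq> carrier K" using xy s by (auto simp: A_def)
    have "countable S"
      unfolding S_def using K.countable_generate[OF A] G(2)
      by (simp add: A_def countable_finite)
    have AS: "A \<subseteq> S" unfolding S_def by (auto intro: generate.incl)
    interpret S: subgroup S K
      unfolding S_def by (rule K.generate_is_subgroup[OF A])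
    define f where "f = to_nat_on S"
    define e where "e = from_nat_into S"
    have ef: "e (f u) = u" if "u \<in> S" for u
      unfolding e_def f_def using \<open>countable S\<close> that by simp
    define L :: "nat monoid" where
      "L = \<lparr>carrier = f ` S, monoid.mult = (\<lambda>a b. f (e a \<otimes>\<^bsub>K\<^esub> e b)), monoid.one = f \<one>\<^bsub>K\<^esub>\<rparr>"
    have L: "group L"
    proof (rule groupI)
      fix a assume "a \<in> carrier L"
      then obtain u where u: "u \<in> S" "a = f u" by (auto simp: L_def)
      show "\<exists>b\<in>carrier L. b \<otimes>\<^bsub>L\<^esub> a = \<one>\<^bsub>L\<^esub>"
        by (rule bexI[of _ "f (inv\<^bsub>K\<^esub> u)"]) (use u in \<open>auto simp: L_def ef\<close>)
    qed (auto simp: L_def ef K.m_assoc)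
    interpret L: group L by fact
    define \<chi> where "\<chi> = \<psi> \<circ> e"
    have \<chi>_f: "\<chi> (f u) = \<psi> u" if "u \<in> S" for u
      using that by (simp add: \<chi>_def ef)
    have "\<chi> \<in> hom L G"
      by (rule homI) (auto simp: L_def \<chi>_f ef)
    then interpret \<chi>: group_hom L G \<chi>
      by unfold_locales
    have "\<chi> ` carrier L = carrier G"
    proof (intro equalityI subsetI)
      fix a assume a: "a \<in> carrier G"
      then have "s a \<in> S" using AS by (auto simp: A_def)
      then have "f (s a) \<in> carrier L" "\<chi> (f (s a)) = a"
        using a by (auto simp: L_def \<chi>_f s)
      then show "a \<in> \<chi> ` carrier L" by (metis imageI)
    qed auto
    define Y where "Y = kernel L G \<chi>"
    define \<rho> where "\<rho> = (\<lambda>X. the_elem (\<chi> ` X))"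
    have "\<rho> \<in> iso (L Mod Y) G"
      unfolding \<rho>_def Y_def using \<open>\<chi> ` carrier L = carrier G\<close> by (rule \<chi>.FactGroup_iso_set)
    moreover have "central_subgroup Y L"
      unfolding central_subgroup_def
    proof (intro conjI ballI)
      show "subgroup Y L" unfolding Y_def by (rule \<chi>.subgroup_kernel)
      fix z a assume "z \<in> Y" and "a \<in> carrier L"
      then obtain u v where "u \<in> S" "v \<in> S" "z = f u" "a = f v" and "\<psi> u = \<one>\<^bsub>G\<^esub>"
        by (auto simp: Y_def kernel_def L_def \<chi>_f)
      moreover from this have "u \<otimes>\<^bsub>K\<^esub> v = v \<otimes>\<^bsub>K\<^esub> u"
        by (intro cent(2) \<psi>_ker) auto
      ultimately show "z \<otimes>\<^bsub>L\<^esub> a = a \<otimes>\<^bsub>L\<^esub> z"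
        by (simp add: L_def ef)
    qed
    ultimately have "central_extension L Y \<rho> G"
      using L by (simp add: central_extension_def)
    then have comm: "preimages_commute L Y \<rho> g h"
      using deep by (simp add: deep_commute_def)
    have \<rho>: "\<rho> (Y #>\<^bsub>L\<^esub> a) = \<chi> a" if a: "a \<in> carrier L" for a
    proof -
      have "\<chi> ` (Y #>\<^bsub>L\<^esub> a) = {\<chi> a}"
      proof (intro equalityI subsetI)
        fix b assume "b \<in> \<chi> ` (Y #>\<^bsub>L\<^esub> a)"
        then show "b \<in> {\<chi> a}"
          using a by (auto simp: r_coset_def Y_def kernel_def)
      next
        fix b assume "b \<in> {\<chi> a}"
        moreover have "a \<in> Y #>\<^bsub>L\<^esub> a"
          unfolding Y_def by (rule L.rcos_self[OF a \<chi>.subgroup_kernel])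
        ultimately show "b \<in> \<chi> ` (Y #>\<^bsub>L\<^esub> a)" by blast
      qed
      then show ?thesis by (simp add: \<rho>_def)
    qed
    have xyS: "x \<in> S" "y \<in> S" using AS by (auto simp: A_def)
    have "f x \<in> carrier L" "f y \<in> carrier L"
      using xyS by (auto simp: L_def)
    moreover from this have "\<rho> (Y #>\<^bsub>L\<^esub> f x) = g" "\<rho> (Y #>\<^bsub>L\<^esub> f y) = h"
      using pre xyS by (auto simp: \<rho> \<chi>_f \<psi>_def)
    ultimately have "f x \<otimes>\<^bsub>L\<^esub> f y = f y \<otimes>\<^bsub>L\<^esub> f x"
      using comm by (auto simp: preimages_commute_def)
    then have "f (x \<otimes>\<^bsub>K\<^esub> y) = f (y \<otimes>\<^bsub>K\<^esub> x)"
      using xyS by (simp add: L_def ef)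
    then show "x \<otimes>\<^bsub>K\<^esub> y = y \<otimes>\<^bsub>K\<^esub> x"
      using xyS ef by (metis S.m_closed)
  qed
qed

end

theory Submission
  imports
    Defs
    "HOL-Number_Theory.Totient"
    "HOL-Algebra.Sylow"
begin

text \<open>An isomorphism preserves the number of vertices and hence the prime divisors of the order, so
  the point is to transfer the existence of an element of order \<open>pq\<close>.

  For the commuting and the deep commuting graph, a maximal clique is an abelian subgroup, and by
  Cauchy's theorem there is an element of order \<open>pq\<close> iff \<open>pq\<close> divides the size of some maximal
  clique.

  In the enhanced power graph the closed neighbourhood of a generator \<open>g\<close> of a maximal cyclic
  subgroup is that subgroup, which is a clique. A closed neighbourhood that is a clique is again a
  maximal cyclic subgroup, so its size is the order of an element.

  In the power graph let \<open>g\<close> generate a maximal cyclic subgroup of order \<open>n\<close> divisible by \<open>pq\<close>,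
  \<open>p < q\<close>, and let \<open>a\<close>, \<open>b\<close> be its \<open>p\<close>-part and \<open>p'\<close>-part. The common neighbours of the
  non-adjacent vertices \<open>a\<close>, \<open>b\<close> are \<open>\<one>\<close> and the generators of \<open>\<langle>g\<rangle>\<close>, which are closed twins. Let
  \<open>x\<close> be the image of \<open>g\<close>. The images of \<open>a\<close> and \<open>b\<close> are not adjacent, so either both are powers
  of \<open>x\<close>, or \<open>x\<close> is a power of both. In the first case a generator of a maximal cyclic subgroup
  containing \<open>x\<close> is a common neighbour of the two images, and its order is \<open>n\<close> or the order of the
  group. In the second case, unless \<open>x\<close> is adjacent to everything, one can arrange that the powers
  of \<open>x\<close> other than \<open>\<one>\<close> are the images of the \<open>\<phi>(n)\<close> generators, so the order of \<open>x\<close> is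
  \<open>\<phi>(n) + 1\<close>, a prime power. The image of an element of order \<open>p\<close> then lies above \<open>x\<close> and
  has at least \<open>(\<phi>(n) + 1)/2\<close> closed twins, but an element of order \<open>p\<close> has at most
  \<open>p - 1 \<le> \<phi>(n)/2\<close> of them.\<close>

subsection \<open>Cyclic subgroups of finite groups\<close>

locale finite_group = group G for G (structure) +
  assumes finite_carrier: "finite (carrier G)"
begin

abbreviation cyc :: "'a \<Rightarrow> 'a set" where
  "cyc x \<equiv> generate G {x}"

lemma cyc_eq: "x \<in> carrier G \<Longrightarrow> cyc x = range (\<lambda>k::int. x [^] k)"
  by (auto simp: generate_pow)

lemma cyc_eq_nat: "x \<in> carrier G \<Longrightarrow> cyc x = range (\<lambda>k::nat. x [^] k)"
  using generate_pow_on_finite_carrier[OF finite_carrier] by auto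

lemma cyc_closed: "x \<in> carrier G \<Longrightarrow> y \<in> cyc x \<Longrightarrow> y \<in> carrier G"
  by (auto simp: cyc_eq)

lemma finite_cyc: "x \<in> carrier G \<Longrightarrow> finite (cyc x)"
  by (rule finite_subset[OF _ finite_carrier]) (auto intro: cyc_closed)

lemma cyc_self: "x \<in> cyc x"
  by (simp add: generate.incl)

lemma one_in_cyc: "\<one> \<in> cyc x"
  by (rule generate.one)

lemma subgroup_cyc: "x \<in> carrier G \<Longrightarrow> subgroup (cyc x) G"
  by (simp add: generate_is_subgroup)

lemma cyc_pow: "x \<in> carrier G \<Longrightarrow> x [^] (k::nat) \<in> cyc x"
  by (auto simp: cyc_eq_nat)

lemma cyc_subset: "x \<in> carrier G \<Longrightarrow> y \<in> cyc x \<Longrightarrow> cyc y \<subseteq> cyc x"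
  by (rule generate_subgroup_incl) (auto simp: subgroup_cyc)

lemma cyc_trans: "x \<in> carrier G \<Longrightarrow> y \<in> cyc x \<Longrightarrow> z \<in> cyc y \<Longrightarrow> z \<in> cyc x"
  using cyc_subset by blast

lemma card_cyc: "x \<in> carrier G \<Longrightarrow> card (cyc x) = ord x"
  using generate_pow_card by simp

lemma ord_pos: "x \<in> carrier G \<Longrightarrow> ord x > 0"
  using ord_ge_1[OF finite_carrier] by force

lemma ord_dvd_cyc:
  assumes "x \<in> carrier G" "y \<in> cyc x"
  shows "ord y dvd ord x"
proof -
  obtain k :: nat where "y = x [^] k" using assms by (auto simp: cyc_eq_nat)
  then have "y [^] ord x = \<one>"
    using assms nat_pow_pow by (metis mult.commute nat_pow_one pow_ord_eq_1)
  then show ?thesis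
    using assms cyc_closed pow_eq_id by blast
qed

text \<open>Divisibility of orders upgrades the inequality to an equality, and an inclusion of
  finite sets of equal size is an equality.\<close>

lemma cyc_eqI:
  assumes "x \<in> carrier G" "y \<in> cyc x" "ord x \<le> ord y"
  shows "cyc y = cyc x"
proof (rule card_subset_eq[OF finite_cyc cyc_subset])
  have "y \<in> carrier G" using assms cyc_closed by blast
  moreover from this have "ord y = ord x"
    using assms ord_dvd_cyc[of x y] ord_pos by (simp add: dvd_imp_le le_antisym)
  ultimately show "card (cyc y) = card (cyc x)"
    using assms(1) by (simp add: card_cyc)
qed (use assms in auto)

lemma cyc_eq_iff_ord: "x \<in> carrier G \<Longrightarrow> cyc y = cyc x \<longleftrightarrow> y \<in> cyc x \<and> ord y = ord x"
  by (metis card_cyc cyc_closed cyc_eqI cyc_self order_refl)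

lemma cyc_ord_exists:
  assumes "x \<in> carrier G" "m dvd ord x"
  obtains y where "y \<in> carrier G" "y \<in> cyc x" "ord y = m"
proof -
  obtain k where k: "ord x = m * k" using assms(2) by auto
  then have "m > 0" "k > 0" using ord_pos[OF assms(1)] by auto
  then have "ord (x [^] k) = m"
    using k assms(1) by (subst ord_pow) auto
  then show ?thesis using that cyc_pow assms(1) by auto
qed

lemma card_generators:
  assumes "x \<in> carrier G"
  shows "card {y \<in> carrier G. cyc y = cyc x} = totient (ord x)"
proof -
  let ?f = "\<lambda>k::nat. x [^] k"
  have "bij_betw ?f (totatives (ord x)) {y \<in> carrier G. cyc y = cyc x}"
    unfolding bij_betw_def
  proof (intro conjI equalityI subsetI)
    have "inj_on ?f {0<..ord x}"
    proof (rule inj_onI)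
      fix i j assume ij: "i \<in> {0<..ord x}" "j \<in> {0<..ord x}" "x [^] i = x [^] j"
      then have "x [^] int i = x [^] int j" by (simp add: int_pow_int)
      then have "int (ord x) dvd int j - int i"
        using int_pow_eq[OF assms] by blast
      moreover have "\<bar>int j - int i\<bar> < int (ord x)" using ij by auto
      ultimately show "i = j"
        by (metis abs_of_nat dvd_imp_le_int eq_iff_diff_eq_0 linorder_not_less of_nat_eq_iff)
    qed
    then show "inj_on ?f (totatives (ord x))"
      by (rule inj_on_subset) (rule totatives_subset)
  next
    fix y assume "y \<in> ?f ` totatives (ord x)"
    then obtain k where k: "k \<in> totatives (ord x)" "y = x [^] k" by auto
    then have "ord y = ord x"
      using pow_ord_eq_ord_iff[OF finite_carrier assms] by (simp add: totatives_def)
    then show "y \<in> {y \<in> carrier G. cyc y = cyc x}"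
      using k assms by (simp add: cyc_eq_iff_ord cyc_pow)
  next
    fix y assume "y \<in> {y \<in> carrier G. cyc y = cyc x}"
    then have y: "y \<in> cyc x" "ord y = ord x" using cyc_eq_iff_ord[OF assms] by auto
    then obtain k :: nat where k: "y = x [^] k" using assms by (auto simp: cyc_eq_nat)
    then have cop: "coprime k (ord x)"
      using y pow_ord_eq_ord_iff[OF finite_carrier assms] by simp
    show "y \<in> ?f ` totatives (ord x)"
    \<comment> \<open>\<open>totatives\<close> takes representatives from 1 to \<open>ord x\<close>,
      while \<open>mod\<close> gives 0 to \<open>ord x - 1\<close>. A residue coprime to
      \<open>ord x\<close> can be 0 only for \<open>ord x = 1\<close>, where the exponent 1 is used
      instead.\<close>
    proof (cases "ord x = 1")
      case True
      then have "x = \<one>" using assms ord_eq_1 by blast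
      then have "y = ?f 1" using k by simp
      moreover have "1 \<in> totatives (ord x)" using True by (simp add: totatives_def)
      ultimately show ?thesis by blast
    next
      case False
      have "int (ord x) dvd int (k mod ord x) - int k"
        by (subst mod_eq_dvd_iff[symmetric]) (simp add: zmod_int)
      then have "x [^] int k = x [^] int (k mod ord x)"
        using int_pow_eq[OF assms] by blast
      then have "y = x [^] (k mod ord x)"
        unfolding k int_pow_int .
      moreover have "coprime (k mod ord x) (ord x)"
        using cop ord_pos[OF assms] by simp
      moreover from this have "k mod ord x \<noteq> 0" using False by (metis coprime_0_left_iff nat_dvd_1_iff_1)
      ultimately show ?thesis
        using ord_pos[OF assms] by (auto simp: totatives_def intro!: image_eqI[of _ _ "k mod ord x"] less_imp_le)
    qed
  qed
  then show ?thesis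
    by (simp add: bij_betw_same_card totient_def)
qed

text \<open>An element of largest order among those that have \<open>x\<close> as a power works:
  whatever lies above it competes as well, and \<open>cyc_eqI\<close> applies.\<close>

lemma maximal_cyclic_exists:
  assumes "x \<in> carrier G"
  obtains u where "u \<in> carrier G" "x \<in> cyc u"
    "\<And>v. v \<in> carrier G \<Longrightarrow> u \<in> cyc v \<Longrightarrow> cyc v = cyc u"
proof -
  let ?S = "{u \<in> carrier G. x \<in> cyc u}"
  have "finite (ord ` ?S)" "ord ` ?S \<noteq> {}"
    using finite_carrier assms cyc_self by auto
  then obtain u where u: "u \<in> ?S" "ord u = Max (ord ` ?S)"
    by (metis (no_types, lifting) Max_in imageE)
  then have max: "ord v \<le> ord u" if "v \<in> ?S" for v
    using that \<open>finite (ord ` ?S)\<close> by simp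
  show ?thesis
  proof (rule that[of u])
    fix v assume v: "v \<in> carrier G" "u \<in> cyc v"
    then have "v \<in> ?S" using u cyc_trans by blast
    then show "cyc v = cyc u" using max cyc_eqI[OF v] by simp
  qed (use u in auto)
qed

section \<open>Cauchy's theorem and products of commuting elements of prime order\<close>

lemma cauchy_subgroup:
  assumes "subgroup C G" "Factorial_Ring.prime p" "p dvd card C"
  obtains c where "c \<in> C" "ord c = p"
proof -
  interpret C: subgroup C G by fact
  let ?C = "G\<lparr>carrier := C\<rparr>"
  have fin: "finite C" using finite_carrier C.subset finite_subset by blast
  obtain k where k: "card C = p * k" using assms(3) by auto
  \<comment> \<open>Sylow's theorem with exponent 1; the cofactor \<open>k\<close> may itself be
    divisible by \<open>p\<close>.\<close>
  obtain P where P: "subgroup P ?C" "card P = p ^ 1"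
    using sylow_thm[OF assms(2) C.subgroup_is_group[OF is_group], of 1 k] fin k by (auto simp: order_def)
  then have P_sub: "subgroup P G" "P \<subseteq> C"
    using incl_subgroup[OF assms(1)] subgroup.subset[OF P(1)] by auto
  have "card P > 1" using P assms(2) prime_gt_1_nat by simp
  then have "\<not> P \<subseteq> {\<one>}" using card_mono[of "{\<one>}" P] by auto
  then obtain c where c: "c \<in> P" "c \<noteq> \<one>" by blast
  have cG: "c \<in> carrier G" using c P_sub(1) subgroup.subset by blast
  interpret P: group "G\<lparr>carrier := P\<rparr>" using subgroup.subgroup_is_group[OF P_sub(1) is_group] .
  have "subgroup (cyc c) (G\<lparr>carrier := P\<rparr>)"
    by (rule subgroup_incl[OF subgroup_cyc[OF cG] P_sub(1)])
      (rule generate_subgroup_incl[OF _ P_sub(1)], simp add: c)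
  then have "card (cyc c) dvd card P"
    using dvd_triv_right P.lagrange[of "cyc c"] by (simp add: order_def) (metis dvd_triv_right)
  then have "ord c dvd p" using P(2) card_cyc[OF cG] by simp
  moreover have "ord c \<noteq> 1" using c cG ord_eq_1 by blast
  ultimately have "ord c = p" using assms(2) by (auto simp: prime_nat_iff)
  then show ?thesis using that c P_sub by blast
qed

lemma cauchy:
  assumes "Factorial_Ring.prime p" "p dvd order G"
  obtains c where "c \<in> carrier G" "ord c = p"
  using cauchy_subgroup[OF subgroup_self] assms unfolding order_def by blast

lemma ord_mult_primes:
  assumes xy: "x \<in> carrier G" "y \<in> carrier G" "x \<otimes> y = y \<otimes> x"
    and "Factorial_Ring.prime p" "Factorial_Ring.prime q" "p \<noteq> q" "ord x = p" "ord y = q"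
  shows "ord (x \<otimes> y) = p * q"
proof -
  have "ord (x \<otimes> y) dvd p * q" using ord_mul_divides[OF xy(3,1,2)] assms by simp
  moreover have "p * q dvd ord (x \<otimes> y)"
  proof -
    let ?n = "ord (x \<otimes> y)"
    have eq: "x [^] k \<otimes> y [^] k = \<one>" if "?n dvd k" for k :: nat
      using that pow_eq_id[of "x \<otimes> y" k] xy pow_mult_distrib[OF xy(3,1,2), of k] by simp
    \<comment> \<open>The extra factor \<open>q\<close> in the exponent kills the power of
      \<open>y\<close>, leaving a condition on \<open>x\<close> alone.\<close>
    have "x [^] (?n * q) = \<one>"
      using eq[of "?n * q"] xy assms pow_eq_id[of y "?n * q"] by simp
    then have "p dvd ?n * q" using pow_eq_id xy assms by auto
    then have "p dvd ?n"
      using assms(4-6) primes_dvd_imp_eq[of p q] by (auto simp: prime_dvd_mult_iff)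
    moreover have "y [^] (?n * p) = \<one>"
      using eq[of "?n * p"] xy assms pow_eq_id[of x "?n * p"] by simp
    then have "q dvd ?n * p" using pow_eq_id xy assms by auto
    then have "q dvd ?n"
      using assms(4-6) primes_dvd_imp_eq[of q p] by (auto simp: prime_dvd_mult_iff)
    ultimately show ?thesis
      using assms by (simp add: divides_mult primes_coprime)
  qed
  ultimately show ?thesis by (rule dvd_antisym)
qed

subsection \<open>Power graphs\<close>

text \<open>Loops are kept here, since \<open>simple_graph\<close> removes them anyway; closed
  neighbourhoods and closed twins can then be expressed directly by the relation.\<close>

definition power_adj :: "'a \<Rightarrow> 'a \<Rightarrow> bool" where
  "power_adj x y \<longleftrightarrow> x \<in> cyc y \<or> y \<in> cyc x"

lemma power_adj_refl: "power_adj x x"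
  by (simp add: power_adj_def cyc_self)

lemma power_adj_commute: "power_adj x y \<longleftrightarrow> power_adj y x"
  by (auto simp: power_adj_def)

lemma power_adj_one: "power_adj \<one> x"
  by (simp add: power_adj_def one_in_cyc)

lemma power_adj_cong:
  assumes "x \<in> carrier G" "y \<in> carrier G" "z \<in> carrier G" "cyc x = cyc y"
  shows "power_adj x z \<longleftrightarrow> power_adj y z"
proof -
  have "x \<in> cyc z \<longleftrightarrow> y \<in> cyc z"
    using assms cyc_trans cyc_self by metis
  then show ?thesis using assms by (simp add: power_adj_def)
qed

lemma power_adj_maximal:
  assumes "\<And>v. v \<in> carrier G \<Longrightarrow> g \<in> cyc v \<Longrightarrow> cyc v = cyc g" "y \<in> carrier G"
  shows "power_adj g y \<longleftrightarrow> y \<in> cyc g"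
  using assms cyc_self unfolding power_adj_def by blast

text \<open>Compare \<open>x\<close> with an element of order \<open>p\<close>: either that element
  is a power of \<open>x\<close>, or \<open>x\<close> is a nontrivial element of a group of order
  \<open>p\<close>.\<close>

lemma dominating_ord:
  assumes "x \<in> carrier G" "x \<noteq> \<one>" "\<And>y. y \<in> carrier G \<Longrightarrow> power_adj x y"
    and "Factorial_Ring.prime p" "p dvd order G"
  shows "p dvd ord x"
proof -
  obtain c where c: "c \<in> carrier G" "ord c = p" using cauchy assms by blast
  from assms(3)[OF c(1)] show ?thesis
    unfolding power_adj_def
  proof
    assume "x \<in> cyc c"
    then have "ord x dvd p" using ord_dvd_cyc c by blast
    moreover have "ord x \<noteq> 1" using assms ord_eq_1 by blast
    ultimately show ?thesis using assms(4) by (auto simp: prime_nat_iff)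
  next
    assume "c \<in> cyc x"
    then show ?thesis using ord_dvd_cyc c assms by blast
  qed
qed

text \<open>The witnesses \<open>a\<close> and \<open>b\<close> are the \<open>p\<close>-part and the \<open>p'\<close>-part of \<open>g\<close>: a common
  neighbour has both of them as powers, hence also \<open>g\<close>, or is a power of both.\<close>

lemma power_adj_common_neighbours:
  assumes g: "g \<in> carrier G"
    and max: "\<And>v. v \<in> carrier G \<Longrightarrow> g \<in> cyc v \<Longrightarrow> cyc v = cyc g"
    and pq: "Factorial_Ring.prime p" "Factorial_Ring.prime q" "p \<noteq> q" "p dvd ord g" "q dvd ord g"
  obtains a b where "a \<in> cyc g" "b \<in> cyc g" "\<not> power_adj a b"
    "\<And>y. y \<in> carrier G \<Longrightarrow> power_adj y a \<Longrightarrow> power_adj y b \<Longrightarrow> y = \<one> \<or> cyc y = cyc g"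
proof -
  define P where "P = p ^ multiplicity p (ord g)"
  obtain m where m: "ord g = P * m" "\<not> p dvd m"
    unfolding P_def using multiplicity_decompose'[of "ord g" p] ord_pos[OF g] pq(1)
    by (metis not_prime_unit not_gr_zero)
  have "P > 0" "m > 0" using m ord_pos[OF g] by auto
  have cop: "coprime P m"
    unfolding P_def using m(2) pq(1) by (simp add: prime_imp_coprime)
  have "p dvd P" using m pq by (metis prime_dvd_mult_iff)
  then have "P \<noteq> 1" using pq(1) by auto
  \<comment> \<open>The prime \<open>q\<close> ensures that the \<open>p'\<close>-part of
    \<open>g\<close> is nontrivial.\<close>
  have "\<not> q dvd P" unfolding P_def
    using pq(3) primes_dvd_imp_eq[OF pq(2,1)] prime_dvd_power[OF pq(2)] by blast
  then have "m \<noteq> 1" using m pq by auto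
  let ?a = "g [^] m" and ?b = "g [^] P"
  have ord_a: "ord ?a = P" and ord_b: "ord ?b = m"
    using m(1) \<open>P > 0\<close> \<open>m > 0\<close> g by (auto simp: ord_pow)
  have ab: "?a \<in> carrier G" "?b \<in> carrier G" using g by auto
  have disj: "z = \<one>" if "z \<in> cyc ?a" "z \<in> cyc ?b" for z
  proof -
    have "ord z dvd P" "ord z dvd m"
      using ord_dvd_cyc[OF ab(1) that(1)] ord_dvd_cyc[OF ab(2) that(2)] ord_a ord_b by auto
    then have "ord z = 1" using cop coprime_common_divisor_nat by blast
    then show ?thesis using that cyc_closed[OF ab(1)] ord_eq_1 by blast
  qed
  have ne: "?a \<noteq> \<one>" "?b \<noteq> \<one>" using ord_a ord_b \<open>P \<noteq> 1\<close> \<open>m \<noteq> 1\<close> ord_id by metis+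
  show ?thesis
  proof (rule that[of ?a ?b])
    show "\<not> power_adj ?a ?b"
      using disj ne cyc_self unfolding power_adj_def by metis
    fix y assume y: "y \<in> carrier G" "power_adj y ?a" "power_adj y ?b"
    consider "y \<in> cyc ?a" "y \<in> cyc ?b" | "y \<in> cyc ?a" "?b \<in> cyc y"
      | "?a \<in> cyc y" "y \<in> cyc ?b" | "?a \<in> cyc y" "?b \<in> cyc y"
      using y unfolding power_adj_def by blast
    then show "y = \<one> \<or> cyc y = cyc g"
    proof cases
      case 1
      then show ?thesis using disj by blast
    next
      case 2
      then have "?b \<in> cyc ?a" using ab cyc_trans by blast
      then show ?thesis using disj ne cyc_self by blast
    next
      case 3
      then have "?a \<in> cyc ?b" using ab cyc_trans by blast
      then show ?thesis using disj ne cyc_self by blast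
    next
      case 4
      \<comment> \<open>Bezout for the coprime exponents recovers \<open>g\<close> as a product of
        powers of \<open>?a\<close> and \<open>?b\<close>.\<close>
      obtain u v where uv: "u * int m + v * int P = 1"
        using cop bezout_int[of "int m" "int P"]
        by (metis coprime_commute coprime_imp_gcd_eq_1 coprime_int_iff)
      have "?a [^] u \<otimes> ?b [^] v = g [^] (u * int m + v * int P)"
        using g by (simp add: int_pow_mult int_pow_pow mult.commute flip: int_pow_int)
      then have "?a [^] u \<otimes> ?b [^] v = g"
        using uv g by (simp add: int_pow_1)
      moreover have "?a [^] u \<otimes> ?b [^] v \<in> cyc y"
        using 4 subgroup_cyc[OF y(1)] subgroup_int_pow_closed subgroup.m_closed by metis
      ultimately show ?thesis using max y(1) by simp
    qed
  qed (use g cyc_pow in auto)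
qed

text \<open>Bounds the closed twins of \<open>e [^] q\<close>, which has order \<open>p\<close>, by
  \<open>p - 1\<close>. A twin \<open>v\<close> is adjacent to \<open>e\<close> but not to
  \<open>e [^] p\<close>, so it is a power of \<open>e\<close> that does not generate
  \<open>cyc e\<close>. If \<open>e [^] q\<close> is a power of \<open>v\<close>, then
  \<open>v\<close> has order \<open>p\<close> or \<open>p * q\<close>, and the second would make it
  a generator.\<close>

lemma twins_of_prime_order:
  assumes e: "e \<in> carrier G" "ord e = p * q"
    and pq: "Factorial_Ring.prime p" "Factorial_Ring.prime q" "p \<noteq> q"
    and v: "v \<in> carrier G" "\<And>z. z \<in> carrier G \<Longrightarrow> power_adj v z \<longleftrightarrow> power_adj (e [^] q) z"
  shows "v \<in> cyc (e [^] q) - {\<one>}"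
proof -
  let ?y = "e [^] q" and ?c = "e [^] p"
  have pos: "p > 0" "q > 0" using pq prime_gt_0_nat by auto
  have y: "?y \<in> carrier G" "ord ?y = p" and c: "?c \<in> carrier G" "ord ?c = q"
    using e pos by (auto simp: ord_pow)
  have "\<not> power_adj ?y ?c"
  proof
    assume "power_adj ?y ?c"
    then have "p dvd q \<or> q dvd p"
      unfolding power_adj_def using ord_dvd_cyc[OF c(1)] ord_dvd_cyc[OF y(1)] y c by metis
    then show False using pq primes_dvd_imp_eq by metis
  qed
  then have nvc: "\<not> power_adj v ?c" using v(2)[OF c(1)] by simp
  then have v1: "v \<noteq> \<one>" using power_adj_one by blast
  have "power_adj v ?y" using v(2)[OF y(1)] power_adj_refl by simp
  then have "?y \<in> cyc v \<or> v \<in> cyc ?y" by (auto simp: power_adj_def)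
  moreover have "v \<in> cyc ?y" if yv: "?y \<in> cyc v"
  proof -
    have "power_adj ?y e" using e cyc_pow by (simp add: power_adj_def)
    then have "power_adj v e" using v(2)[OF e(1)] by simp
    moreover have "e \<notin> cyc v"
      using nvc v(1) cyc_trans[OF v(1), of e ?c] cyc_pow[OF e(1)] unfolding power_adj_def by blast
    ultimately have ve: "v \<in> cyc e" by (simp add: power_adj_def)
    have "p dvd ord v" using ord_dvd_cyc[OF v(1) yv] y by simp
    then obtain k where k: "ord v = p * k" by auto
    have "ord v dvd p * q" using ord_dvd_cyc[OF e(1) ve] e by simp
    then have "k dvd q" using k pos by simp
    then consider "k = 1" | "k = q" using pq(2) by (auto simp: prime_nat_iff)
    then show ?thesis
    proof cases
      case 1
      then have "cyc ?y = cyc v" using cyc_eqI[OF v(1) yv] k y by simp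
      then show ?thesis using cyc_self by blast
    next
      case 2
      then have "cyc v = cyc e" using cyc_eqI[OF e(1) ve] k e by simp
      then show ?thesis using \<open>e \<notin> cyc v\<close> cyc_self by blast
    qed
  qed
  ultimately show ?thesis using v1 by blast
qed

text \<open>The bound fails for orders such as 6, but for a power of a prime \<open>r\<close> it
  reduces to \<open>r \<le> 2 * (r - 1)\<close>.\<close>

lemma ord_le_double_totient:
  assumes x: "x \<in> carrier G" "x \<noteq> \<one>"
    and chain: "\<And>y z. y \<in> cyc x \<Longrightarrow> z \<in> cyc x \<Longrightarrow> power_adj y z"
  shows "ord x \<le> 2 * totient (ord x)"
proof -
  \<comment> \<open>The chain condition forces \<open>ord x\<close> to be a prime power.\<close>
  have "ord x \<noteq> 1" using x ord_eq_1 by blast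
  then obtain r where r: "Factorial_Ring.prime r" "r dvd ord x" using prime_factor_nat by blast
  have uniq: "s = r" if s: "Factorial_Ring.prime s" "s dvd ord x" for s
  proof -
    obtain y where y: "y \<in> carrier G" "y \<in> cyc x" "ord y = r" using cyc_ord_exists[OF x(1) r(2)] .
    obtain z where z: "z \<in> carrier G" "z \<in> cyc x" "ord z = s" using cyc_ord_exists[OF x(1) s(2)] .
    have "r dvd s \<or> s dvd r"
      using chain[OF y(2) z(2)] ord_dvd_cyc[OF y(1)] ord_dvd_cyc[OF z(1)] y z
      unfolding power_adj_def by metis
    then show ?thesis using r s primes_dvd_imp_eq by metis
  qed
  obtain m where m: "ord x = r ^ multiplicity r (ord x) * m" "\<not> r dvd m"
    using multiplicity_decompose'[of "ord x" r] ord_pos[OF x(1)] r(1)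
    by (metis not_prime_unit not_gr_zero)
  have "m = 1"
  proof (rule ccontr)
    assume "m \<noteq> 1"
    then obtain s where s: "Factorial_Ring.prime s" "s dvd m" using prime_factor_nat by blast
    then have "s = r" using uniq m(1) by (metis dvd_mult)
    then show False using s m by blast
  qed
  then have eq: "ord x = r ^ multiplicity r (ord x)" using m by simp
  obtain k where k: "multiplicity r (ord x) = Suc k"
    using eq \<open>ord x \<noteq> 1\<close> by (metis not0_implies_Suc power_0)
  have "r \<le> 2 * (r - 1)" using prime_ge_2_nat[OF r(1)] by simp
  then have "r ^ k * r \<le> r ^ k * (2 * (r - 1))" by (rule mult_le_mono2)
  then show ?thesis
    using eq k totient_prime_power_Suc[OF r(1), of k] by (simp add: mult.commute mult.left_commute)
qed

end

text \<open>The primes are ordered because the final count needs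
  \<open>2 * (p - 1) \<le> totient (p * q)\<close>, which rests on \<open>q \<ge> 3\<close>.\<close>

lemma power_graph_prime_edge_less:
  fixes G :: "('a, 'm) monoid_scheme" and H :: "('b, 'n) monoid_scheme"
  assumes "finite_group G" "finite_group H"
    and f: "bij_betw f (carrier H) (carrier G)"
    and adj: "\<And>x y. x \<in> carrier H \<Longrightarrow> y \<in> carrier H \<Longrightarrow>
      finite_group.power_adj H x y \<longleftrightarrow> finite_group.power_adj G (f x) (f y)"
    and pq: "Factorial_Ring.prime p" "Factorial_Ring.prime q" "p < q"
    and h: "h \<in> carrier H" "p * q dvd group.ord H h"
  shows "\<exists>x\<in>carrier G. p * q dvd group.ord G x"
proof -
  interpret G: finite_group G by fact
  interpret H: finite_group H by fact
  have fG: "f y \<in> carrier G" if "y \<in> carrier H" for y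
    using f that by (auto simp: bij_betw_def)
  have f_inj: "y = z" if "f y = f z" "y \<in> carrier H" "z \<in> carrier H" for y z
    using f that by (auto simp: bij_betw_def dest: inj_onD)
  have f_surj: "\<exists>y\<in>carrier H. f y = z" if "z \<in> carrier G" for z
    using that bij_betw_imp_surj_on[OF f] by (metis imageE)
  have card_GH: "order G = order H" using bij_betw_same_card[OF f] by (simp add: order_def)

  obtain g0 where g0: "g0 \<in> carrier H" "h \<in> H.cyc g0"
    "\<And>v. v \<in> carrier H \<Longrightarrow> g0 \<in> H.cyc v \<Longrightarrow> H.cyc v = H.cyc g0"
    using H.maximal_cyclic_exists[OF h(1)] by blast
  define D where "D = {y \<in> carrier H. H.cyc y = H.cyc g0}"
  let ?M = "(\<lambda>y. G.ord (f y)) ` D"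
  have fin_M: "finite ?M" "?M \<noteq> {}"
    using H.finite_carrier g0(1) by (auto simp: D_def)
  \<comment> \<open>Among the generators of a maximal cyclic subgroup, \<open>g\<close> is chosen so that the cyclic subgroup
    generated by its image is as large as possible.\<close>
  obtain g where gD: "g \<in> D" and gMax: "Max ?M = G.ord (f g)"
    using Max_in[OF fin_M] by (rule imageE)
  have ord_max: "G.ord (f y) \<le> G.ord (f g)" if "y \<in> D" for y
    unfolding gMax[symmetric] using that fin_M(1) by (intro Max_ge) auto
  have g: "g \<in> carrier H" "H.cyc g = H.cyc g0" using gD by (auto simp: D_def)
  have D: "D = {y \<in> carrier H. H.cyc y = H.cyc g}" unfolding D_def g(2) ..
  have g_max: "H.cyc v = H.cyc g" if "v \<in> carrier H" "g \<in> H.cyc v" for v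
  proof -
    have "g0 \<in> H.cyc v" using that H.cyc_subset g(2) H.cyc_self by blast
    then show ?thesis using g0(3) that g(2) by simp
  qed
  have N_g: "H.power_adj g y \<longleftrightarrow> y \<in> H.cyc g" if "y \<in> carrier H" for y
    using H.power_adj_maximal g_max that by blast
  have pq_g: "p * q dvd H.ord g"
    using h(2) H.ord_dvd_cyc[OF g(1)] g0(2) g(2) by (metis dvd_trans)
  then have p_g: "p dvd H.ord g" and q_g: "q dvd H.ord g"
    by (auto intro: dvd_trans[rotated])
  have pq_G: "p * q dvd order G"
    unfolding card_GH using pq_g H.ord_dvd_group_order[OF g(1)] by (rule dvd_trans)
  have cop: "coprime p q" using pq primes_coprime by blast
  have both: "p * q dvd n" if "p dvd n" "q dvd n" for n
    using divides_mult[OF that cop] .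
  have p_ge: "p \<ge> 2" and q_ge: "q \<ge> 3" using pq prime_ge_2_nat[OF pq(1)] by auto

  have card_D: "card D = totient (H.ord g)" using H.card_generators[OF g(1)] by (simp add: D)
  have "totient (p * q) \<le> totient (H.ord g)"
    by (rule totient_dvd_mono[OF pq_g H.ord_pos[OF g(1)]])
  moreover have "totient (p * q) = (p - 1) * (q - 1)"
    using cop pq by (simp add: totient_mult_coprime totient_prime)
  moreover have "(p - 1) * 2 \<le> (p - 1) * (q - 1)" using q_ge by (intro mult_le_mono2) simp
  ultimately have D_ge: "2 * (p - 1) \<le> card D"
    unfolding card_D by linarith

  define x where "x = f g"
  have x: "x \<in> carrier G" unfolding x_def using fG g by blast
  \<comment> \<open>Elements of \<open>D\<close> generate the same subgroup and are closed twins, a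
    property that every graph isomorphism preserves.\<close>
  have twins: "G.power_adj (f y) z \<longleftrightarrow> G.power_adj x z" if yz: "y \<in> D" "z \<in> carrier G" for y z
  proof -
    obtain w where w: "w \<in> carrier H" "f w = z" using f_surj[OF yz(2)] by blast
    have "H.power_adj y w \<longleftrightarrow> H.power_adj g w"
      using H.power_adj_cong[of y g w] yz g w by (auto simp: D)
    then show ?thesis using adj[of y w] adj[of g w] w g yz by (simp add: D x_def)
  qed
  \<comment> \<open>Otherwise the maximal choice of \<open>g\<close> would send all of
    \<open>D\<close> to the identity, but \<open>D\<close> has at least two elements.\<close>
  have x_ne: "x \<noteq> \<one>\<^bsub>G\<^esub>"
  proof
    assume x1: "x = \<one>\<^bsub>G\<^esub>"
    have "f y = \<one>\<^bsub>G\<^esub>" if "y \<in> D" for y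
    proof -
      have "y \<in> carrier H" using that by (auto simp: D)
      then show ?thesis
        using ord_max[OF that] G.ord_pos[OF fG] G.ord_eq_1[OF fG] x1 x_def
        by (metis G.ord_id Suc_leI le_antisym One_nat_def)
    qed
    then have "D \<subseteq> {g}" using f_inj gD by (fastforce simp: D)
    then have "card D \<le> 1" using card_mono[of "{g}" D] by simp
    then show False using D_ge p_ge by simp
  qed

  obtain a b where ab: "a \<in> H.cyc g" "b \<in> H.cyc g" "\<not> H.power_adj a b"
    and common: "\<And>y. y \<in> carrier H \<Longrightarrow> H.power_adj y a \<Longrightarrow> H.power_adj y b
      \<Longrightarrow> y = \<one>\<^bsub>H\<^esub> \<or> H.cyc y = H.cyc g"
    using H.power_adj_common_neighbours[OF g(1) g_max pq(1,2) _ p_g q_g] pq(3) by blast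
  have abH: "a \<in> carrier H" "b \<in> carrier H" using ab g H.cyc_closed by auto
  have fab: "f a \<in> carrier G" "f b \<in> carrier G" using abH fG by auto
  have x_ab: "G.power_adj x (f a)" "G.power_adj x (f b)"
    using adj[OF g(1)] abH ab N_g by (auto simp: x_def)
  have n_ab: "\<not> G.power_adj (f a) (f b)" using adj abH ab(3) by simp
  have common_G: "y = f \<one>\<^bsub>H\<^esub> \<or> y \<in> f ` D"
    if y: "y \<in> carrier G" "G.power_adj y (f a)" "G.power_adj y (f b)" for y
  proof -
    obtain w where w: "w \<in> carrier H" "f w = y" using f_surj[OF y(1)] by blast
    then have "w = \<one>\<^bsub>H\<^esub> \<or> H.cyc w = H.cyc g" using common[of w] adj w y abH by auto
    then show ?thesis using w by (auto simp: D)
  qed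
  consider "f a \<in> G.cyc x" "f b \<in> G.cyc x" | "x \<in> G.cyc (f a)" "x \<in> G.cyc (f b)"
  proof -
    \<comment> \<open>A mixed case would make one of \<open>f a\<close>, \<open>f b\<close> a power
      of the other by way of \<open>x\<close>.\<close>
    have "\<not> (f a \<in> G.cyc x \<and> x \<in> G.cyc (f b))" "\<not> (f b \<in> G.cyc x \<and> x \<in> G.cyc (f a))"
      using n_ab G.cyc_trans fab unfolding G.power_adj_def by blast+
    then show thesis using x_ab that unfolding G.power_adj_def by blast
  qed
  then show ?thesis
  proof cases
    \<comment> \<open>Every element above \<open>x\<close> is then a common neighbour of \<open>f a\<close> and \<open>f b\<close>, hence so is \<open>u\<close>.\<close>
    case 1
    obtain u where u: "u \<in> carrier G" "x \<in> G.cyc u"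
      "\<And>v. v \<in> carrier G \<Longrightarrow> u \<in> G.cyc v \<Longrightarrow> G.cyc v = G.cyc u"
      using G.maximal_cyclic_exists[OF x] by blast
    have N_u: "G.power_adj u y \<longleftrightarrow> y \<in> G.cyc u" if "y \<in> carrier G" for y
      using G.power_adj_maximal u(3) that by blast
    have "G.power_adj u (f a)" "G.power_adj u (f b)"
      using 1 N_u fab G.cyc_trans[OF u(1,2)] by auto
    then consider "u = f \<one>\<^bsub>H\<^esub>" | "u \<in> f ` D" using common_G[OF u(1)] by blast
    then have "p * q dvd G.ord u"
    proof cases
      case 1
      \<comment> \<open>Here \<open>u\<close> is adjacent to everything, as the identity of
        \<open>H\<close> is, so by maximality it generates the whole group.\<close>
      have "carrier G \<subseteq> G.cyc u"
      proof
        fix z assume z: "z \<in> carrier G"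
        then obtain w where w: "w \<in> carrier H" "f w = z" using f_surj[OF z] by blast
        then have "G.power_adj u z" using adj[of "\<one>\<^bsub>H\<^esub>" w] H.power_adj_one 1 by simp
        then show "z \<in> G.cyc u" using N_u z by blast
      qed
      then have "G.cyc u = carrier G" using G.cyc_closed u(1) by blast
      then show ?thesis using G.card_cyc[OF u(1)] pq_G by (simp add: order_def)
    next
      case 2
      then obtain y where y: "y \<in> D" "u = f y" by blast
      \<comment> \<open>Both sets are closed neighbourhoods of generators of maximal cyclic
        subgroups, and \<open>u\<close> is a closed twin of \<open>x = f g\<close>.\<close>
      have "bij_betw f (H.cyc g) (G.cyc u)"
        unfolding bij_betw_def
      proof (intro conjI equalityI subsetI)
        show "inj_on f (H.cyc g)" using f_inj H.cyc_closed[OF g(1)] by (intro inj_onI) blast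
      next
        fix z assume "z \<in> f ` H.cyc g"
        then obtain w where w: "w \<in> H.cyc g" "z = f w" by blast
        then have wH: "w \<in> carrier H" using H.cyc_closed g(1) by blast
        then have "G.power_adj x z" using w adj[OF g(1) wH] N_g by (simp add: x_def)
        then show "z \<in> G.cyc u" using N_u twins y w fG wH by blast
      next
        fix z assume zu: "z \<in> G.cyc u"
        then have z: "z \<in> carrier G" using G.cyc_closed u(1) by blast
        then obtain w where w: "w \<in> carrier H" "f w = z" using f_surj[OF z] by blast
        have "G.power_adj x z" using N_u twins y zu z by blast
        then have "w \<in> H.cyc g" using adj[OF g(1) w(1)] w N_g by (simp add: x_def)
        then show "z \<in> f ` H.cyc g" using w by blast
      qed
      then have "G.ord u = H.ord g"
        using bij_betw_same_card G.card_cyc[OF u(1)] H.card_cyc[OF g(1)] by metis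
      then show ?thesis using pq_g by simp
    qed
    then show ?thesis using u by blast
  next
    \<comment> \<open>Either \<open>x\<close> is adjacent to everything, or the powers of \<open>x\<close> other than \<open>\<one>\<close> are exactly the
      images of the generators of \<open>\<langle>g\<rangle>\<close>; the latter is excluded by counting.\<close>
    case 2
    \<comment> \<open>A power of \<open>x\<close> is a power of both \<open>f a\<close> and
      \<open>f b\<close>, hence one of their common neighbours.\<close>
    have cyc_x: "y = f \<one>\<^bsub>H\<^esub> \<or> y \<in> f ` D" if "y \<in> G.cyc x" for y
    proof (rule common_G)
      show "y \<in> carrier G" using that x G.cyc_closed by blast
      show "G.power_adj y (f a)" "G.power_adj y (f b)"
        using 2 that G.cyc_trans fab unfolding G.power_adj_def by blast+
    qed
    show ?thesis
    proof (cases "\<one>\<^bsub>G\<^esub> \<in> f ` D")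
      case True
      then obtain y where y: "\<one>\<^bsub>G\<^esub> = f y" "y \<in> D" by (rule imageE)
      \<comment> \<open>\<open>x\<close> is now a closed twin of the identity.\<close>
      have "G.power_adj x z" if "z \<in> carrier G" for z
        using twins[OF y(2) that] G.power_adj_one[of z] y(1) by simp
      then have "p dvd G.ord x" "q dvd G.ord x"
        using G.dominating_ord[OF x x_ne] pq pq_G by (meson dvd_mult_left dvd_mult_right)+
      then show ?thesis using both x by blast
    next
      case False
      then have f1: "f \<one>\<^bsub>H\<^esub> = \<one>\<^bsub>G\<^esub>" using cyc_x[OF G.one_in_cyc] by auto
      have cyc_x_eq: "G.cyc x = insert \<one>\<^bsub>G\<^esub> (f ` D)"
      proof (intro equalityI subsetI)
        fix z assume "z \<in> G.cyc x"
        then show "z \<in> insert \<one>\<^bsub>G\<^esub> (f ` D)" using cyc_x f1 by auto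
      next
        fix z assume "z \<in> insert \<one>\<^bsub>G\<^esub> (f ` D)"
        then consider "z = \<one>\<^bsub>G\<^esub>" | y where "y \<in> D" "z = f y" by blast
        then show "z \<in> G.cyc x"
        proof cases
          case 2
          then have z: "z \<in> carrier G" using fG by (auto simp: D)
          have "G.power_adj z x" using twins[OF 2(1) x] 2 G.power_adj_refl by blast
          \<comment> \<open>The choice of \<open>g\<close> enters here: the order of
            \<open>z\<close> does not exceed that of \<open>x\<close>.\<close>
          moreover have "G.cyc x = G.cyc z" if "x \<in> G.cyc z"
            using G.cyc_eqI[OF z that] ord_max[OF 2(1)] 2 by (simp add: x_def)
          ultimately show ?thesis using G.cyc_self unfolding G.power_adj_def by blast
        qed (simp add: G.one_in_cyc)
      qed
      have "inj_on f D" by (rule inj_onI, rule f_inj) (auto simp: D)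
      then have "card (G.cyc x) = Suc (card D)"
        unfolding cyc_x_eq using False H.finite_carrier
        by (subst card_insert_disjoint) (auto simp: card_image D)
      then have ord_x: "G.ord x = Suc (card D)" using G.card_cyc[OF x] by simp
      have tw: "G.power_adj y x" if "y \<in> G.cyc x" for y
        using that by (simp add: G.power_adj_def)
      \<comment> \<open>Nontrivial powers of \<open>x\<close> are its closed twins, so like
        \<open>x\<close> they are adjacent to all of \<open>G.cyc x\<close>.\<close>
      have chain: "G.power_adj y z" if yz: "y \<in> G.cyc x" "z \<in> G.cyc x" for y z
      proof -
        have zG: "z \<in> carrier G" using yz x G.cyc_closed by blast
        from yz(1) consider "y = \<one>\<^bsub>G\<^esub>" | w where "w \<in> D" "y = f w"
          unfolding cyc_x_eq by blast
        then show ?thesis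
        proof cases
          case 2
          then show ?thesis using twins[OF 2(1) zG] tw[OF yz(2)] G.power_adj_commute by blast
        qed (simp add: G.power_adj_one)
      qed
      have ord_le: "G.ord x \<le> 2 * totient (G.ord x)"
        by (rule G.ord_le_double_totient[OF x x_ne chain])
      obtain e where e: "e \<in> carrier H" "e \<in> H.cyc g" "H.ord e = p * q"
        using H.cyc_ord_exists[OF g(1) pq_g] .
      let ?y = "e [^]\<^bsub>H\<^esub> q"
      have y: "?y \<in> carrier H" "H.ord ?y = p"
        using e q_ge by (auto simp: H.ord_pow)
      have yg: "?y \<in> H.cyc g" using H.cyc_trans[OF g(1) e(2)] H.cyc_pow[OF e(1)] by blast
      \<comment> \<open>As \<open>?y\<close> is neither a generator of \<open>H.cyc g\<close> nor
        trivial, \<open>f ?y\<close> is not a power of \<open>x\<close>; adjacency then puts it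
        above \<open>x\<close>.\<close>
      have "?y \<notin> D"
      proof
        assume "?y \<in> D"
        then have "H.ord g = p" using H.card_cyc[OF g(1)] H.card_cyc[OF y(1)] y by (simp add: D)
        then show False using pq_g p_ge q_ge by (auto dest: dvd_imp_le)
      qed
      moreover have "?y \<noteq> \<one>\<^bsub>H\<^esub>" using y p_ge by auto
      ultimately have "f ?y \<notin> G.cyc x"
        unfolding cyc_x_eq using f1 f_inj y(1) by (auto simp: D)
      moreover have "G.power_adj x (f ?y)" using adj[OF g(1) y(1)] N_g[OF y(1)] yg by (simp add: x_def)
      ultimately have xy: "x \<in> G.cyc (f ?y)" by (simp add: G.power_adj_def)
      have fy: "f ?y \<in> carrier G" using fG y by blast
      \<comment> \<open>Generators of the same subgroup are closed twins, so their preimages are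
        closed twins of \<open>?y\<close>.\<close>
      have "{z \<in> carrier G. G.cyc z = G.cyc (f ?y)} \<subseteq> f ` (H.cyc ?y - {\<one>\<^bsub>H\<^esub>})"
      proof
        fix z assume z: "z \<in> {z \<in> carrier G. G.cyc z = G.cyc (f ?y)}"
        then obtain v where v: "v \<in> carrier H" "f v = z" using f_surj[of z] z by auto
        have "v \<in> H.cyc ?y - {\<one>\<^bsub>H\<^esub>}"
        proof (rule H.twins_of_prime_order[OF e(1,3) pq(1,2)])
          show "p \<noteq> q" using pq by simp
          fix w assume w: "w \<in> carrier H"
          have "G.power_adj z (f w) \<longleftrightarrow> G.power_adj (f ?y) (f w)"
            using G.power_adj_cong[of z "f ?y" "f w"] z fG w y by auto
          then show "H.power_adj v w \<longleftrightarrow> H.power_adj ?y w"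
            using adj[OF v(1) w] adj[OF y(1) w] v by simp
        qed (rule v)
        then show "z \<in> f ` (H.cyc ?y - {\<one>\<^bsub>H\<^esub>})" using v by blast
      qed
      then have "totient (G.ord (f ?y)) \<le> card (H.cyc ?y - {\<one>\<^bsub>H\<^esub>})"
        unfolding G.card_generators[OF fy, symmetric]
        using H.finite_cyc[OF y(1)] by (meson card_image_le card_mono finite_Diff finite_imageI order_trans)
      also have "\<dots> = p - 1"
        using H.card_cyc[OF y(1)] y H.finite_cyc[OF y(1)] by (simp add: card_Diff_singleton H.one_in_cyc)
      finally have "totient (G.ord (f ?y)) \<le> p - 1" .
      moreover have "totient (G.ord x) \<le> totient (G.ord (f ?y))"
        by (rule totient_dvd_mono[OF G.ord_dvd_cyc[OF fy xy] G.ord_pos[OF fy]])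
      \<comment> \<open>The two sides are linked by \<open>G.ord x\<close>, twice its totient, and
        twice the totient of \<open>G.ord (f ?y)\<close>.\<close>
      ultimately have "Suc (card D) \<le> 2 * (p - 1)" using ord_le ord_x by simp
      then show ?thesis using D_ge by simp
    qed
  qed
qed

lemma power_graph_prime_edge:
  fixes G :: "('a, 'm) monoid_scheme" and H :: "('b, 'n) monoid_scheme"
  assumes "finite_group G" "finite_group H" "bij_betw f (carrier H) (carrier G)"
    and "\<And>x y. x \<in> carrier H \<Longrightarrow> y \<in> carrier H \<Longrightarrow>
      finite_group.power_adj H x y \<longleftrightarrow> finite_group.power_adj G (f x) (f y)"
    and pq: "Factorial_Ring.prime p" "Factorial_Ring.prime q" "p \<noteq> q"
    and h: "h \<in> carrier H" "p * q dvd group.ord H h"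
  shows "\<exists>x\<in>carrier G. p * q dvd group.ord G x"
proof (cases "p < q")
  case True
  show ?thesis by (rule power_graph_prime_edge_less[OF assms(1-6) True h])
next
  case False
  then have "q < p" using pq(3) by simp
  then show ?thesis
    using power_graph_prime_edge_less[OF assms(1-4) pq(2,1) _ h(1)] h(2) by (simp add: mult.commute)
qed

subsection \<open>Enhanced power graphs\<close>

context finite_group
begin

text \<open>Membership in a common cyclic subgroup makes the link to maximal cyclic subgroups
  immediate.\<close>

definition enhanced_adj :: "'a \<Rightarrow> 'a \<Rightarrow> bool" where
  "enhanced_adj x y \<longleftrightarrow> (\<exists>z\<in>carrier G. x \<in> cyc z \<and> y \<in> cyc z)"

lemma enhanced_adj_refl: "x \<in> carrier G \<Longrightarrow> enhanced_adj x x"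
  unfolding enhanced_adj_def using cyc_self by blast

text \<open>If both elements are powers of \<open>z\<close>, with exponents \<open>i\<close> and
  \<open>j\<close>, then by Bezout \<open>z [^] gcd i j\<close> lies in the subgroup they generate
  and generates it.\<close>

lemma cyclic_subgroup_generated_iff:
  assumes xy: "x \<in> carrier G" "y \<in> carrier G"
  shows "cyclic_group (subgroup_generated G {x, y}) \<longleftrightarrow> enhanced_adj x y"
proof -
  let ?S = "subgroup_generated G {x, y}"
  have sub: "subgroup (generate G {x, y}) G" using xy by (simp add: generate_is_subgroup)
  have car: "carrier ?S = generate G {x, y}"
    using xy by (simp add: carrier_subgroup_generated)
  have gen: "x \<in> generate G {x, y}" "y \<in> generate G {x, y}" by (auto intro: generate.incl)
  have in_G: "w \<in> carrier G" if "w \<in> generate G {x, y}" for w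
    using that sub subgroup.subset by blast
  have range: "range (\<lambda>n::int. w [^]\<^bsub>?S\<^esub> n) = cyc w" if "w \<in> generate G {x, y}" for w
    using that by (simp add: int_pow_subgroup_generated car cyc_eq in_G)
  have "cyclic_group ?S \<longleftrightarrow> (\<exists>w\<in>generate G {x, y}. generate G {x, y} = cyc w)"
    using group.cyclic_group[OF group_subgroup_generated[of "{x, y}"]] range by (simp add: car)
  also have "\<dots> \<longleftrightarrow> enhanced_adj x y"
  proof
    assume "\<exists>w\<in>generate G {x, y}. generate G {x, y} = cyc w"
    then show "enhanced_adj x y" unfolding enhanced_adj_def using gen in_G by blast
  next
    assume "enhanced_adj x y"
    then obtain z i j where z: "z \<in> carrier G" "x = z [^] (i::int)" "y = z [^] (j::int)"
      by (auto simp: enhanced_adj_def cyc_eq)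
    obtain u v where uv: "u * i + v * j = gcd i j" using bezout_int by blast
    define w where "w = z [^] gcd i j"
    have "x [^] u \<otimes> y [^] v = w"
      using z(1) by (simp add: z(2,3) w_def int_pow_pow mult.commute uv[symmetric] flip: int_pow_mult)
    moreover have "x [^] u \<otimes> y [^] v \<in> generate G {x, y}"
      using gen sub subgroup_int_pow_closed subgroup.m_closed by metis
    ultimately have w: "w \<in> generate G {x, y}" by simp
    have "x = w [^] (i div gcd i j)" "y = w [^] (j div gcd i j)"
      using z(1) by (simp_all add: z(2,3) w_def int_pow_pow)
    then have "{x, y} \<subseteq> cyc w" using cyc_eq[OF in_G[OF w]] by auto
    then have "generate G {x, y} \<subseteq> cyc w"
      using generate_subgroup_incl subgroup_cyc[OF in_G[OF w]] by blast
    moreover have "cyc w \<subseteq> generate G {x, y}"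
      using generate_subgroup_incl[OF _ sub] w by simp
    ultimately show "\<exists>w\<in>generate G {x, y}. generate G {x, y} = cyc w" using w by blast
  qed
  finally show ?thesis .
qed

end

text \<open>The image of a maximal cyclic subgroup \<open>cyc g\<close> is the maximal cyclic
  subgroup \<open>cyc u\<close> above \<open>f g\<close>, so the two orders agree.\<close>

lemma enhanced_power_graph_ord_dvd:
  fixes G :: "('a, 'm) monoid_scheme" and H :: "('b, 'n) monoid_scheme"
  assumes "finite_group G" "finite_group H"
    and f: "bij_betw f (carrier H) (carrier G)"
    and adj: "\<And>x y. x \<in> carrier H \<Longrightarrow> y \<in> carrier H \<Longrightarrow>
      finite_group.enhanced_adj H x y \<longleftrightarrow> finite_group.enhanced_adj G (f x) (f y)"
    and h: "h \<in> carrier H" "m dvd group.ord H h"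
  shows "\<exists>x\<in>carrier G. m dvd group.ord G x"
proof -
  interpret G: finite_group G by fact
  interpret H: finite_group H by fact
  have fG: "f y \<in> carrier G" if "y \<in> carrier H" for y
    using f that by (auto simp: bij_betw_def)
  have f_surj: "\<exists>y\<in>carrier H. f y = z" if "z \<in> carrier G" for z
    using that bij_betw_imp_surj_on[OF f] by (metis imageE)
  obtain g where g: "g \<in> carrier H" "h \<in> H.cyc g"
    "\<And>v. v \<in> carrier H \<Longrightarrow> g \<in> H.cyc v \<Longrightarrow> H.cyc v = H.cyc g"
    using H.maximal_cyclic_exists[OF h(1)] by blast
  have N_g: "y \<in> H.cyc g" if "H.enhanced_adj g y" for y
    using that g(3) unfolding H.enhanced_adj_def by blast
  have fg: "f g \<in> carrier G" using fG g by blast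
  obtain u where u: "u \<in> carrier G" "f g \<in> G.cyc u"
    and u_max: "\<And>v. v \<in> carrier G \<Longrightarrow> u \<in> G.cyc v \<Longrightarrow> G.cyc v = G.cyc u"
    using G.maximal_cyclic_exists[OF fg] by blast
  obtain w where w: "w \<in> carrier H" "f w = u" using f_surj u by blast
  have "G.enhanced_adj (f g) u" unfolding G.enhanced_adj_def using u G.cyc_self by blast
  \<comment> \<open>It is not claimed that \<open>w\<close> generates \<open>H.cyc g\<close>;
    membership makes it adjacent to that whole set.\<close>
  then have wg: "w \<in> H.cyc g" using adj[OF g(1) w(1)] w N_g by simp
  have "f ` H.cyc g = G.cyc u"
  proof (intro equalityI subsetI)
    fix z assume "z \<in> f ` H.cyc g"
    then obtain y where y: "y \<in> H.cyc g" "z = f y" by blast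
    then have yH: "y \<in> carrier H" using H.cyc_closed g(1) by blast
    have "H.enhanced_adj w y" unfolding H.enhanced_adj_def using wg y g by blast
    then have "G.enhanced_adj u z" using adj[OF w(1) yH] w y by simp
    then show "z \<in> G.cyc u" unfolding G.enhanced_adj_def using u_max by blast
  next
    fix z assume z: "z \<in> G.cyc u"
    then obtain y where y: "y \<in> carrier H" "f y = z" using f_surj G.cyc_closed u by blast
    have "G.enhanced_adj (f g) z" unfolding G.enhanced_adj_def using u z by blast
    then have "y \<in> H.cyc g" using adj[OF g(1) y(1)] y N_g by simp
    then show "z \<in> f ` H.cyc g" using y by blast
  qed
  moreover have "inj_on f (H.cyc g)"
    using inj_on_subset[OF bij_betw_imp_inj_on[OF f]] H.cyc_closed[OF g(1)] by blast
  ultimately have "G.ord u = H.ord g"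
    using card_image[of f "H.cyc g"] G.card_cyc[OF u(1)] H.card_cyc[OF g(1)] by simp
  then have "m dvd G.ord u"
    using h(2) H.ord_dvd_cyc[OF g(1,2)] by (metis dvd_trans)
  then show ?thesis using u by blast
qed

subsection \<open>Commuting and deep commuting graphs\<close>

text \<open>Abstracts what commuting and deep commuting share: a relation finer than commutation for
  which the elements related to a given one form a subgroup. Inverses are covered because they are
  positive powers in a finite group.\<close>

locale commuting_relation = finite_group G for G (structure) +
  fixes R :: "'a \<Rightarrow> 'a \<Rightarrow> bool"
  assumes refl: "x \<in> carrier G \<Longrightarrow> R x x"
    and sym: "x \<in> carrier G \<Longrightarrow> y \<in> carrier G \<Longrightarrow> R x y \<Longrightarrow> R y x"
    and mult: "x \<in> carrier G \<Longrightarrow> y \<in> carrier G \<Longrightarrow> z \<in> carrier G \<Longrightarrow> R x y \<Longrightarrow> R x z \<Longrightarrow> R x (y \<otimes> z)"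
    and comm: "x \<in> carrier G \<Longrightarrow> y \<in> carrier G \<Longrightarrow> R x y \<Longrightarrow> x \<otimes> y = y \<otimes> x"
begin

lemma cyc:
  assumes x: "x \<in> carrier G" and y: "y \<in> carrier G" "R y x" and z: "z \<in> cyc x"
  shows "R y z"
proof -
  have Suc: "R y (x [^] Suc k)" for k
    by (induction k) (use mult x y in auto)
  obtain k :: nat where k: "z = x [^] k" using z x by (auto simp: cyc_eq_nat)
  \<comment> \<open>Shifting by \<open>ord x\<close> makes the exponent positive, as the induction
    starts at exponent 1.\<close>
  then have "z = x [^] (k + ord x)" using x by (simp flip: nat_pow_mult)
  moreover have "k + ord x = Suc (k + ord x - 1)" using ord_pos[OF x] by simp
  ultimately show ?thesis using Suc by metis
qed

lemma cyc_clique: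
  assumes "x \<in> carrier G" "y \<in> cyc x" "z \<in> cyc x"
  shows "R y z"
  using assms cyc refl sym cyc_closed by metis

definition clique :: "'a set \<Rightarrow> bool" where
  "clique C \<longleftrightarrow> C \<subseteq> carrier G \<and> (\<forall>x\<in>C. \<forall>y\<in>C. R x y)"

text \<open>By \<open>refl\<close> and \<open>sym\<close> this is maximality under inclusion, tested
  on single elements so that it transfers easily along a bijection.\<close>

definition maximal_clique :: "'a set \<Rightarrow> bool" where
  "maximal_clique C \<longleftrightarrow> clique C \<and> (\<forall>z\<in>carrier G. (\<forall>x\<in>C. R x z) \<longrightarrow> z \<in> C)"

lemma maximal_clique_exists:
  assumes "clique B"
  obtains C where "B \<subseteq> C" "maximal_clique C"
proof -
  let ?S = "{C. B \<subseteq> C \<and> clique C}"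
  have "?S \<subseteq> Pow (carrier G)" by (auto simp: clique_def)
  then have fin: "finite ?S" using finite_carrier finite_subset by blast
  moreover have "?S \<noteq> {}" using assms by blast
  ultimately obtain C where C: "C \<in> ?S" "\<And>C'. C' \<in> ?S \<Longrightarrow> C \<subseteq> C' \<Longrightarrow> C = C'"
    by (metis (no_types, lifting) finite_has_maximal)
  have "z \<in> C" if z: "z \<in> carrier G" "\<forall>x\<in>C. R x z" for z
  proof -
    have "insert z C \<in> ?S"
      using C(1) z refl sym by (auto simp: clique_def)
    then show ?thesis using C(2) by blast
  qed
  then show ?thesis using that[of C] C(1) by (auto simp: maximal_clique_def)
qed

text \<open>Products and inverses of elements of \<open>C\<close> stay related to all of
  \<open>C\<close>, so maximality puts them into \<open>C\<close>.\<close>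

lemma maximal_clique_subgroup:
  assumes "maximal_clique C"
  shows "subgroup C G"
proof (rule subgroupI)
  have sub: "C \<subseteq> carrier G" and R: "\<And>x y. x \<in> C \<Longrightarrow> y \<in> C \<Longrightarrow> R x y"
    and max: "\<And>z. z \<in> carrier G \<Longrightarrow> (\<And>x. x \<in> C \<Longrightarrow> R x z) \<Longrightarrow> z \<in> C"
    using assms by (auto simp: maximal_clique_def clique_def)
  show "C \<subseteq> carrier G" by fact
  show "C \<noteq> {}" using max[OF one_closed] by blast
  fix a assume a: "a \<in> C"
  have aG: "a \<in> carrier G" using a sub by blast
  have "inv a \<in> cyc a" using aG by (simp add: generate.inv)
  then show "inv a \<in> C"
    using cyc[OF aG] R a sub aG by (intro max) auto
  fix b assume b: "b \<in> C"
  then have "b \<in> carrier G" using sub by blast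
  then show "a \<otimes> b \<in> C"
    using mult[OF _ aG] R a b sub aG by (intro max) auto
qed

lemma maximal_clique_ord:
  assumes "maximal_clique C"
    and pq: "Factorial_Ring.prime p" "Factorial_Ring.prime q" "p \<noteq> q" "p dvd card C" "q dvd card C"
  shows "\<exists>x\<in>carrier G. ord x = p * q"
proof -
  have sub: "subgroup C G" by (rule maximal_clique_subgroup[OF assms(1)])
  obtain c where c: "c \<in> C" "ord c = p" using cauchy_subgroup[OF sub] pq by blast
  obtain d where d: "d \<in> C" "ord d = q" using cauchy_subgroup[OF sub] pq by blast
  have cd: "c \<in> carrier G" "d \<in> carrier G" "R c d"
    using assms(1) c d by (auto simp: maximal_clique_def clique_def)
  then have "ord (c \<otimes> d) = p * q"
    using ord_mult_primes[OF cd(1,2) comm[OF cd] pq(1-3) c(2) d(2)] by simp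
  then show ?thesis using cd by blast
qed

end

text \<open>Only the size of a maximal clique is carried over: Lagrange puts the factor
  \<open>p * q\<close> into it in \<open>H\<close>, and Cauchy extracts an element from it in
  \<open>G\<close>.\<close>

lemma commuting_relation_prime_edge:
  fixes G :: "('a, 'm) monoid_scheme" and H :: "('b, 'n) monoid_scheme"
  assumes "commuting_relation G R" "commuting_relation H S"
    and f: "bij_betw f (carrier H) (carrier G)"
    and adj: "\<And>x y. x \<in> carrier H \<Longrightarrow> y \<in> carrier H \<Longrightarrow> S x y \<longleftrightarrow> R (f x) (f y)"
    and pq: "Factorial_Ring.prime p" "Factorial_Ring.prime q" "p \<noteq> q"
    and h: "h \<in> carrier H" "group.ord H h = p * q"
  shows "\<exists>x\<in>carrier G. group.ord G x = p * q"
proof -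
  interpret G: commuting_relation G R by fact
  interpret H: commuting_relation H S by fact
  have "H.clique (H.cyc h)"
    unfolding H.clique_def using H.cyc_clique[OF h(1)] H.cyc_closed[OF h(1)] by blast
  then obtain C where C: "H.cyc h \<subseteq> C" "H.maximal_clique C"
    using H.maximal_clique_exists by blast
  have CH: "C \<subseteq> carrier H" using C(2) by (auto simp: H.maximal_clique_def H.clique_def)
  interpret C: subgroup C H by (rule H.maximal_clique_subgroup[OF C(2)])
  interpret CG: group "H\<lparr>carrier := C\<rparr>" using C.subgroup_is_group[OF H.is_group] .
  have "subgroup (H.cyc h) (H\<lparr>carrier := C\<rparr>)"
    by (rule H.subgroup_incl[OF H.subgroup_cyc[OF h(1)] C.subgroup_axioms C(1)])
  then have "card (H.cyc h) dvd card C"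
    using CG.lagrange[of "H.cyc h"] by (simp add: order_def) (metis dvd_triv_right)
  then have pq_C: "p * q dvd card C" using H.card_cyc[OF h(1)] h(2) by simp
  have "G.maximal_clique (f ` C)"
    unfolding G.maximal_clique_def G.clique_def
  proof (intro conjI ballI impI)
    show "f ` C \<subseteq> carrier G" using f CH by (auto simp: bij_betw_def)
  next
    fix x y assume "x \<in> f ` C" "y \<in> f ` C"
    then show "R x y" using C(2) adj CH by (auto simp: H.maximal_clique_def H.clique_def)
  next
    fix z assume z: "z \<in> carrier G" "\<forall>x\<in>f ` C. R x z"
    then obtain w where w: "w \<in> carrier H" "z = f w"
      using bij_betw_imp_surj_on[OF f] by (metis imageE)
    then have "\<forall>x\<in>C. S x w" using z adj CH by blast
    then show "z \<in> f ` C" using w C(2) by (auto simp: H.maximal_clique_def)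
  qed
  moreover have "card (f ` C) = card C"
    using inj_on_subset[OF bij_betw_imp_inj_on[OF f] CH] by (rule card_image)
  ultimately show ?thesis
    using G.maximal_clique_ord[of "f ` C" p q] pq pq_C by (auto dest: dvd_mult_left dvd_mult_right)
qed

section \<open>The two instances of \<open>commuting_relation\<close>\<close>

lemma (in finite_group) commuting_relation_commute:
  "commuting_relation G (\<lambda>x y. x \<otimes> y = y \<otimes> x)"
proof
  fix x y z
  assume xyz: "x \<in> carrier G" "y \<in> carrier G" "z \<in> carrier G"
    and "x \<otimes> y = y \<otimes> x" "x \<otimes> z = z \<otimes> x"
  then show "x \<otimes> (y \<otimes> z) = y \<otimes> z \<otimes> x"
    by (metis m_assoc)
qed auto

text \<open>Recasts an extension as a surjective homomorphism; two preimages of one element commute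
  because they differ by a central factor.\<close>

lemma central_extension_preimages:
  fixes K :: "('k, 'n) monoid_scheme" and G :: "('a, 'm) monoid_scheme"
  assumes ext: "central_extension K Z \<pi> G"
  defines "\<psi> \<equiv> \<lambda>x. \<pi> (Z #>\<^bsub>K\<^esub> x)"
  shows "\<psi> \<in> hom K G" "\<And>a. a \<in> carrier G \<Longrightarrow> \<exists>x\<in>carrier K. \<psi> x = a"
    "\<And>x y. x \<in> carrier K \<Longrightarrow> y \<in> carrier K \<Longrightarrow> \<psi> x = \<psi> y \<Longrightarrow> x \<otimes>\<^bsub>K\<^esub> y = y \<otimes>\<^bsub>K\<^esub> x"
proof -
  interpret K: group K using ext by (simp add: central_extension_def)
  have Z: "subgroup Z K" and cent: "\<And>z x. z \<in> Z \<Longrightarrow> x \<in> carrier K \<Longrightarrow> z \<otimes>\<^bsub>K\<^esub> x = x \<otimes>\<^bsub>K\<^esub> z"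
    and iso: "\<pi> \<in> iso (K Mod Z) G"
    using ext by (auto simp: central_extension_def central_subgroup_def)
  interpret Z: subgroup Z K by fact
  interpret Z: normal Z K
    by (rule K.normalI[OF Z]) (auto simp: r_coset_def l_coset_def cent)
  show "\<psi> \<in> hom K G"
    using hom_compose[OF Z.r_coset_hom_Mod, of \<pi> G] iso by (simp add: \<psi>_def iso_def comp_def)
  show "\<exists>x\<in>carrier K. \<psi> x = a" if "a \<in> carrier G" for a
  proof -
    have "a \<in> \<pi> ` carrier (K Mod Z)" using iso that by (auto simp: iso_def bij_betw_def)
    then show ?thesis by (auto simp: FactGroup_def RCOSETS_def \<psi>_def)
  qed
  show "x \<otimes>\<^bsub>K\<^esub> y = y \<otimes>\<^bsub>K\<^esub> x" if xy: "x \<in> carrier K" "y \<in> carrier K" "\<psi> x = \<psi> y" for x y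
  proof -
    have "Z #>\<^bsub>K\<^esub> x \<in> carrier (K Mod Z)" "Z #>\<^bsub>K\<^esub> y \<in> carrier (K Mod Z)"
      using xy by (auto simp: FactGroup_def RCOSETS_def)
    then have "Z #>\<^bsub>K\<^esub> x = Z #>\<^bsub>K\<^esub> y"
      using xy(3) iso by (auto simp: iso_def bij_betw_def \<psi>_def dest: inj_onD)
    then have "x \<in> Z #>\<^bsub>K\<^esub> y" using K.rcos_self[OF xy(1) Z] by simp
    then obtain z where "z \<in> Z" "x = z \<otimes>\<^bsub>K\<^esub> y" by (auto simp: r_coset_def)
    then show ?thesis using cent[of z y] xy by (simp add: K.m_assoc)
  qed
qed

lemma (in finite_group) commuting_relation_deep_commute:
  "commuting_relation G (deep_commute G)"
proof
  fix x assume "x \<in> carrier G"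
  show "deep_commute G x x"
    unfolding deep_commute_def preimages_commute_def
  proof (intro allI impI ballI)
    fix K :: "nat monoid" and Z \<pi> u v
    assume "central_extension K Z \<pi> G" "u \<in> carrier K" "v \<in> carrier K"
      "\<pi> (Z #>\<^bsub>K\<^esub> u) = x" "\<pi> (Z #>\<^bsub>K\<^esub> v) = x"
    then show "u \<otimes>\<^bsub>K\<^esub> v = v \<otimes>\<^bsub>K\<^esub> u"
      using central_extension_preimages(3)[of K Z \<pi> G u v] by simp
  qed
next
  fix x y assume "deep_commute G x y"
  then show "deep_commute G y x"
    unfolding deep_commute_def preimages_commute_def by (simp add: eq_commute)
next
  fix x y z
  assume xyz: "x \<in> carrier G" "y \<in> carrier G" "z \<in> carrier G"
    and xy: "deep_commute G x y" and xz: "deep_commute G x z"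
  show "deep_commute G x (y \<otimes> z)"
    unfolding deep_commute_def preimages_commute_def
  proof (intro allI impI ballI)
    fix K :: "nat monoid" and Z \<pi> u v
    assume ext: "central_extension K Z \<pi> G" and uv: "u \<in> carrier K" "v \<in> carrier K"
      and u: "\<pi> (Z #>\<^bsub>K\<^esub> u) = x" and v: "\<pi> (Z #>\<^bsub>K\<^esub> v) = y \<otimes> z"
    interpret K: group K using ext by (simp add: central_extension_def)
    let ?\<psi> = "\<lambda>u. \<pi> (Z #>\<^bsub>K\<^esub> u)"
    note hom = central_extension_preimages(1)[OF ext]
    interpret \<psi>: group_hom K G ?\<psi>
      by unfold_locales (rule hom)
    obtain s where s: "s \<in> carrier K" "?\<psi> s = y"
      using central_extension_preimages(2)[OF ext xyz(2)] by blast
    \<comment> \<open>The preimage \<open>v\<close> of the product is prescribed, so the preimage of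
      \<open>z\<close> is taken as a quotient to give \<open>v = s \<otimes> t\<close>
      exactly.\<close>
    define t where "t = inv\<^bsub>K\<^esub> s \<otimes>\<^bsub>K\<^esub> v"
    have t: "t \<in> carrier K" using s uv by (simp add: t_def)
    have "?\<psi> t = ?\<psi> (inv\<^bsub>K\<^esub> s) \<otimes> ?\<psi> v"
      unfolding t_def using s uv by (intro \<psi>.hom_mult) auto
    also have "\<dots> = z"
      using s v xyz \<psi>.hom_inv[OF s(1)] by (simp add: m_assoc[symmetric])
    finally have "u \<otimes>\<^bsub>K\<^esub> t = t \<otimes>\<^bsub>K\<^esub> u"
      using xz ext uv t u unfolding deep_commute_def preimages_commute_def by blast
    moreover have "u \<otimes>\<^bsub>K\<^esub> s = s \<otimes>\<^bsub>K\<^esub> u"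
      using xy ext uv s u unfolding deep_commute_def preimages_commute_def by blast
    moreover have "v = s \<otimes>\<^bsub>K\<^esub> t"
      using s uv by (simp add: t_def K.m_assoc[symmetric])
    ultimately show "u \<otimes>\<^bsub>K\<^esub> v = v \<otimes>\<^bsub>K\<^esub> u"
      using uv s t by (metis K.m_assoc)
  qed
next
  fix x y assume xy: "x \<in> carrier G" "y \<in> carrier G" "deep_commute G x y"
  \<comment> \<open>The trivial extension has the element type of \<open>G\<close> instead of
    \<open>nat\<close>, which \<open>deep_commute_preimages_commute\<close> allows.\<close>
  have "central_extension G {\<one>} the_elem G"
    unfolding central_extension_def central_subgroup_def
    using trivial_factor_iso triv_subgroup is_group by simp
  then have "preimages_commute G {\<one>} the_elem x y"
    by (rule deep_commute_preimages_commute[OF is_group finite_carrier xy(3)])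
  then show "x \<otimes> y = y \<otimes> x"
    using xy by (simp add: preimages_commute_def r_coset_def)
qed

subsection \<open>The four types of graph\<close>

text \<open>Reflexive forms of the adjacencies, so that an isomorphism respects them for all pairs
  and not only for distinct vertices.\<close>

fun group_adj :: "graph_type \<Rightarrow> ('a, 'm) monoid_scheme \<Rightarrow> 'a \<Rightarrow> 'a \<Rightarrow> bool" where
  "group_adj Commuting G = (\<lambda>x y. x \<otimes>\<^bsub>G\<^esub> y = y \<otimes>\<^bsub>G\<^esub> x)"
| "group_adj Power G = finite_group.power_adj G"
| "group_adj Enhanced_Power G = finite_group.enhanced_adj G"
| "group_adj Deep_Commuting G = deep_commute G"

lemma simple_graph_cong:
  "(\<And>x y. x \<in> V \<Longrightarrow> y \<in> V \<Longrightarrow> adj x y \<longleftrightarrow> adj' x y) \<Longrightarrow> simple_graph V adj = simple_graph V adj'"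
  by (auto simp: simple_graph_def)

lemma (in finite_group) group_graph_eq: "group_graph T G = simple_graph (carrier G) (group_adj T G)"
  by (cases T)
    (auto simp: commuting_graph_def power_graph_def enhanced_power_graph_def deep_commuting_graph_def
      cyclic_subgroup_generated_iff power_adj_def cyc_eq intro!: simple_graph_cong)

lemma (in finite_group) group_adj_refl: "x \<in> carrier G \<Longrightarrow> group_adj T G x x"
  using commuting_relation.refl[OF commuting_relation_deep_commute]
  by (cases T) (auto simp: power_adj_refl enhanced_adj_refl)

lemma group_graph_prime_edge:
  fixes G :: "('a, 'm) monoid_scheme" and H :: "('b, 'n) monoid_scheme"
  assumes G: "finite_group G" and H: "finite_group H"
    and f: "bij_betw f (carrier H) (carrier G)"
    and adj: "\<And>x y. x \<in> carrier H \<Longrightarrow> y \<in> carrier H \<Longrightarrow> group_adj T H x y \<longleftrightarrow> group_adj T G (f x) (f y)"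
    and pq: "Factorial_Ring.prime p" "Factorial_Ring.prime q" "p \<noteq> q"
    and h: "h \<in> carrier H" "group.ord H h = p * q"
  shows "\<exists>x\<in>carrier G. group.ord G x = p * q"
proof -
  interpret G: finite_group G by fact
  interpret H: finite_group H by fact
  \<comment> \<open>Divisibility suffices, since a suitable power then has order exactly
    \<open>p * q\<close>.\<close>
  have ord: ?thesis if "\<exists>x\<in>carrier G. p * q dvd G.ord x"
    using that G.cyc_ord_exists by metis
  show ?thesis
  proof (cases T)
    case Commuting
    show ?thesis
      by (rule commuting_relation_prime_edge[OF G.commuting_relation_commute
            H.commuting_relation_commute f _ pq h])
        (use adj in \<open>simp add: Commuting\<close>)
  next
    case Power
    then show ?thesis
      using power_graph_prime_edge[OF G H f _ pq h(1)] adj h(2) by (intro ord) simp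
  next
    case Enhanced_Power
    then show ?thesis
      using enhanced_power_graph_ord_dvd[OF G H f _ h(1), of "p * q"] adj h(2) by (intro ord) simp
  next
    case Deep_Commuting
    show ?thesis
      by (rule commuting_relation_prime_edge[OF G.commuting_relation_deep_commute
            H.commuting_relation_deep_commute f _ pq h])
        (use adj in \<open>simp add: Deep_Commuting\<close>)
  qed
qed

theorem theorem1p6:
  fixes G :: "('a, 'm) monoid_scheme" and H :: "('b, 'n) monoid_scheme"
    and T :: graph_type
  assumes "group G" and "finite (carrier G)"
    and "group H" and "finite (carrier H)"
    and "graph_isomorphic (group_graph T G) (group_graph T H)"
  shows "gruenberg_kegel_graph G = gruenberg_kegel_graph H"
proof -
  have fin: "finite_group G" "finite_group H"
    using assms by (simp_all add: finite_group_def finite_group_axioms_def)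
  interpret G: finite_group G by fact
  interpret H: finite_group H by fact
  obtain f where f: "bij_betw f (carrier G) (carrier H)"
    and ne: "\<And>x y. x \<in> carrier G \<Longrightarrow> y \<in> carrier G \<Longrightarrow> x \<noteq> y \<Longrightarrow>
      group_adj T G x y \<longleftrightarrow> group_adj T H (f x) (f y)"
    using assms(5) unfolding G.group_graph_eq H.group_graph_eq graph_isomorphic_simple_graph by blast
  have fH: "f x \<in> carrier H" if "x \<in> carrier G" for x
    using f that by (auto simp: bij_betw_def)
  have adj: "group_adj T G x y \<longleftrightarrow> group_adj T H (f x) (f y)" if "x \<in> carrier G" "y \<in> carrier G" for x y
    using ne[OF that] that G.group_adj_refl H.group_adj_refl fH by (cases "x = y") auto
  define f' where "f' = inv_into (carrier G) f"
  have f': "bij_betw f' (carrier H) (carrier G)"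
    unfolding f'_def by (rule bij_betw_inv_into[OF f])
  have ff': "f (f' y) = y" and f'G: "f' y \<in> carrier G" if "y \<in> carrier H" for y
    using that f' bij_betw_inv_into_right[OF f that] by (auto simp: f'_def bij_betw_def)
  have adj': "group_adj T H x y \<longleftrightarrow> group_adj T G (f' x) (f' y)"
    if "x \<in> carrier H" "y \<in> carrier H" for x y
    using adj[of "f' x" "f' y"] that by (simp add: ff' f'G)
  have "(\<exists>x\<in>carrier G. G.ord x = p * q) \<longleftrightarrow> (\<exists>x\<in>carrier H. H.ord x = p * q)"
    if "Factorial_Ring.prime p" "Factorial_Ring.prime q" "p \<noteq> q" for p q
    using group_graph_prime_edge[OF fin f' adj' that] group_graph_prime_edge[OF fin(2,1) f adj that]
    by blast
  moreover have "order G = order H"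
    using bij_betw_same_card[OF f] by (simp add: order_def)
  ultimately show ?thesis
    by (auto simp: gruenberg_kegel_graph_def simple_graph_def)
qed

end
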